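(* Let $V$ be a finite set, let $\mu$ be a distribution over $\{-1,+1\}^V$ and let $\eta>0$. If $\mu$ is $\eta$-spectrally independent in $\infty$-norm with all fields, then for every $\theta\in(0,1)$, $$\rho^{\mathrm{GD}}(\mu)\ \ge\ \left(\frac{\theta}{\mathrm{e}}\right)^{\eta+3}\rho^{\mathrm{GD}}_{\min}(\mu^{(\theta)}).$$
   Context: For a distribution $\mu$ over $\{-1,+1\}^V$, $\Omega(\mu)$ is its support, $\mu_S$ the marginal on $S\subseteq V$ (with $\mu_v=\mu_{\{v\}}$), and for $\Lambda\subseteq V$, $\sigma\in\Omega(\mu_\Lambda)$, $\mu^{\sigma}=\mu^{\Lambda\gets\sigma}$ is the distribution over $\{-1,+1\}^V$ obtained from $\mu$ by conditioning on the configuration on $\Lambda$ being $\sigma$; $\mu_v^{\sigma}$ is its marginal at $v$. Local fields: for $\boldsymbol{\lambda}\in\mathbb{R}_{>0}^V$, $\mu^{(\boldsymbol\lambda)}$ is the distribution with $\mu^{(\boldsymbol\lambda)}(\sigma)\propto\mu(\sigma)\prod_{v:\sigma_v=+1}\lambda_v$; for a scalar $\theta>0$, $\mu^{(\theta)}$ is $\mu^{(\boldsymbol\lambda)}$ with $\lambda_v=\theta$ for all $v$. Spectral independence: the signed influence matrix $\Psi^{\mathrm{inf}}_\mu\in\mathbb{R}^{V\times V}$ has $\Psi^{\mathrm{inf}}_\mu(u,v)=\mu_v^{u\gets+1}(+1)-\mu_v^{u\gets-1}(+1)$ if $u\ne v$ and $\Omega(\mu_u)=\{-1,+1\}$, and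 $0$ otherwise. $\mu$ is $\eta$-spectrally independent in $\infty$-norm if $\|\Psi^{\mathrm{inf}}_\mu\|_\infty=\max_{u\in V}\sum_{v\in V}|\Psi^{\mathrm{inf}}_\mu(u,v)|\le\eta$; it is so with all fields if $\mu^{(\boldsymbol\lambda)}$ is $\eta$-spectrally independent in $\infty$-norm for all $\boldsymbol\lambda\in\mathbb{R}_{>0}^V$. Glauber dynamics and modified log-Sobolev constant: the Glauber dynamics on $\mu$ is the chain on $\Omega(\mu)$ with transition matrix $P=P^{\mathrm{GD}}_\mu$ that picks $v\in V$ uniformly at random (from all of $V$) and resamples the value at $v$ from the conditional distribution of $\mu$ at $v$ given the values on $V\setminus\{v\}$. For $f:\Omega(\mu)\to\mathbb{R}_{\ge0}$, $\mathcal{E}_P(f,\log f)=\langle f,(I-P)\log f\rangle_\mu$ with $\langle f,g\rangle_\mu=\sum_\sigma f(\sigma)g(\sigma)\mu(\sigma)$ (possibly $+\infty$), and $\mathbf{Ent}_\mu[f]=\mathbf{E}_\mu[f\log f]-\mathbf{E}_\mu[f]\log\mathbf{E}_\mu[f]$, with the convention $0\log0=0$. Then $$\rho^{\mathrm{GD}}(\mu)=\inf\left\{\frac{\mathcal{E}_P(f,\log f)}{\mathbf{Ent}_\mu[f]}: f:\Omega(\mu)\to\mathbb{R}_{\ge0},\ \mathbf{Ent}_\mu[f]\ne0\right\}$$ (infimum of the empty set is $+\infty$). For a distribution $\pi$ over $\{-1,+1\}^V$, $\rho^{\mathrm{GD}}_{\min}(\pi)=\min_{\Lambda\subset V}\min_{\sigma\in\Omega(\pi_\Lambda)}\rho^{\mathrm{GD}}(\pi^\sigma)$,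 where $\Lambda=\emptyset$ (no conditioning) is allowed and $\pi^\sigma$ is regarded as a distribution over $\{-1,+1\}^V$. *)

theory Defs
  imports "HOL-Probability.Probability"
begin

text \<open>
  The finite ground set \<open>V\<close> is the universe of a finite type \<open>'v\<close>, and a configuration in
  \<open>{-1,+1}\<^sup>V\<close> is a function \<open>'v \<Rightarrow> bool\<close>, where \<open>True\<close> stands for \<open>+1\<close> and \<open>False\<close> for \<open>-1\<close>.
  The support \<open>\<Omega>(\<mu>)\<close> is \<open>set_pmf \<mu>\<close>.
\<close>

type_synonym 'v config = "'v \<Rightarrow> bool"

text \<open>A configuration on \<open>S\<close> is a function that is \<open>undefined\<close> outside \<open>S\<close>.\<close>

definition marginal :: "'v config pmf \<Rightarrow> 'v set \<Rightarrow> 'v config pmf" where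
  "marginal \<mu> S = map_pmf (\<lambda>\<sigma>. restrict \<sigma> S) \<mu>"

definition marginal_at :: "'v config pmf \<Rightarrow> 'v \<Rightarrow> bool pmf" where
  "marginal_at \<mu> v = map_pmf (\<lambda>\<sigma>. \<sigma> v) \<mu>"

text \<open>
  Only the values of \<open>\<sigma>\<close> on \<open>\<Lambda>\<close> matter. As with \<^const>\<open>cond_pmf\<close>, the result is meaningful only
  if the conditioning event has positive probability.
\<close>

definition pin :: "'v config pmf \<Rightarrow> 'v set \<Rightarrow> 'v config \<Rightarrow> 'v config pmf" where
  "pin \<mu> \<Lambda> \<sigma> = cond_pmf \<mu> {\<tau>. \<forall>v\<in>\<Lambda>. \<tau> v = \<sigma> v}"

definition field_weight :: "'v::finite config pmf \<Rightarrow> ('v \<Rightarrow> real) \<Rightarrow> 'v config \<Rightarrow> real" where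
  "field_weight \<mu> lam \<sigma> = pmf \<mu> \<sigma> * (\<Prod>v | \<sigma> v. lam v)"

definition with_field :: "'v::finite config pmf \<Rightarrow> ('v \<Rightarrow> real) \<Rightarrow> 'v config pmf" where
  "with_field \<mu> lam = embed_pmf (\<lambda>\<sigma>. field_weight \<mu> lam \<sigma> / (\<Sum>\<tau>\<in>UNIV. field_weight \<mu> lam \<tau>))"

lemma pmf_with_field:
  assumes "\<And>v. lam v > 0"
  shows "pmf (with_field \<mu> lam) \<sigma> = field_weight \<mu> lam \<sigma> / (\<Sum>\<tau>\<in>UNIV. field_weight \<mu> lam \<tau>)"
proof -
  have nonneg: "field_weight \<mu> lam \<tau> \<ge> 0" for \<tau>
    unfolding field_weight_def using assms by (intro mult_nonneg_nonneg prod_nonneg) (auto intro: less_imp_le)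
  obtain \<tau> where \<tau>: "\<tau> \<in> set_pmf \<mu>"
    using set_pmf_not_empty[of \<mu>] by blast
  have "field_weight \<mu> lam \<tau> > 0"
    unfolding field_weight_def using assms \<tau> by (intro mult_pos_pos prod_pos) (auto simp: pmf_positive)
  hence pos: "(\<Sum>\<tau>\<in>UNIV. field_weight \<mu> lam \<tau>) > 0"
    using nonneg by (intro sum_pos2[of _ \<tau>]) auto
  show ?thesis
    unfolding with_field_def
  proof (rule pmf_embed_pmf)
    show "0 \<le> field_weight \<mu> lam x / (\<Sum>\<tau>\<in>UNIV. field_weight \<mu> lam \<tau>)" for x
      using nonneg pos by simp
    have "(\<integral>\<^sup>+x. ennreal (field_weight \<mu> lam x / (\<Sum>\<tau>\<in>UNIV. field_weight \<mu> lam \<tau>)) \<partial>count_space UNIV)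
          = ennreal (\<Sum>x\<in>UNIV. field_weight \<mu> lam x / (\<Sum>\<tau>\<in>UNIV. field_weight \<mu> lam \<tau>))"
      using nonneg pos by (simp add: nn_integral_count_space_finite sum_ennreal)
    also have "\<dots> = 1"
      using pos by (simp flip: sum_divide_distrib)
    finally show "(\<integral>\<^sup>+x. ennreal (field_weight \<mu> lam x / (\<Sum>\<tau>\<in>UNIV. field_weight \<mu> lam \<tau>)) \<partial>count_space UNIV) = 1" .
  qed
qed

definition influence_matrix :: "'v::finite config pmf \<Rightarrow> real ^ 'v ^ 'v" where
  "influence_matrix \<mu> = (\<chi> u v.
     if u \<noteq> v \<and> set_pmf (marginal_at \<mu> u) = {False, True}
     then pmf (marginal_at (pin \<mu> {u} (\<lambda>_. True)) v) True
        - pmf (marginal_at (pin \<mu> {u} (\<lambda>_. False)) v) True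
     else 0)"

definition matrix_norm_infty :: "real ^ 'n ^ 'm \<Rightarrow> real" where
  "matrix_norm_infty A = Max (range (\<lambda>u. \<Sum>v\<in>UNIV. \<bar>A $ u $ v\<bar>))"

definition spectrally_independent_infty :: "real \<Rightarrow> 'v::finite config pmf \<Rightarrow> bool" where
  "spectrally_independent_infty \<eta> \<mu> \<longleftrightarrow> matrix_norm_infty (influence_matrix \<mu>) \<le> \<eta>"

definition spectrally_independent_infty_all_fields :: "real \<Rightarrow> 'v::finite config pmf \<Rightarrow> bool" where
  "spectrally_independent_infty_all_fields \<eta> \<mu> \<longleftrightarrow>
     (\<forall>lam. (\<forall>v. lam v > 0) \<longrightarrow> spectrally_independent_infty \<eta> (with_field \<mu> lam))"

text \<open>
  One step of the Glauber dynamics from \<open>\<sigma>\<close>. For \<open>\<sigma> \<in> set_pmf \<mu>\<close> the event conditioned on has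
  positive probability, and the step stays in \<open>set_pmf \<mu>\<close>.
\<close>

definition glauber_step :: "'v::finite config pmf \<Rightarrow> 'v config \<Rightarrow> 'v config pmf" where
  "glauber_step \<mu> \<sigma> =
     bind_pmf (pmf_of_set UNIV)
       (\<lambda>v. map_pmf (\<lambda>x. \<sigma>(v := x)) (marginal_at (pin \<mu> (UNIV - {v}) \<sigma>) v))"

definition glauber :: "'v::finite config pmf \<Rightarrow> 'v config \<Rightarrow> 'v config \<Rightarrow> real" where
  "glauber \<mu> \<sigma> \<tau> = pmf (glauber_step \<mu> \<sigma>) \<tau>"

text \<open>The logarithm on \<open>[0,\<infinity>)\<close> with \<open>log 0 = -\<infinity>\<close>.\<close>

definition ext_ln :: "real \<Rightarrow> ereal" where
  "ext_ln x = (if x = 0 then -\<infinity> else ereal (ln x))"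

text \<open>
  \<open>\<langle>f, (I - P) log f\<rangle>\<^sub>\<mu>\<close>, for a transition matrix \<open>P\<close> on \<open>set_pmf \<mu>\<close>. Since \<open>0 * x = 0\<close> for every
  extended real \<open>x\<close>, the summands with \<open>f \<sigma> = 0\<close> or \<open>P \<sigma> \<tau> = 0\<close> vanish. If \<open>f \<sigma> > 0\<close> then
  \<open>ext_ln (f \<sigma>)\<close> is finite and the inner sum is less than \<open>\<infinity>\<close>, so every summand of the outer
  sum is greater than \<open>-\<infinity>\<close> and no \<open>\<infinity> - \<infinity>\<close> affects the value.
\<close>

definition dirichlet_form_ln :: "'a pmf \<Rightarrow> ('a \<Rightarrow> 'a \<Rightarrow> real) \<Rightarrow> ('a \<Rightarrow> real) \<Rightarrow> ereal" where
  "dirichlet_form_ln \<mu> P f =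
     (\<Sum>\<sigma>\<in>set_pmf \<mu>.
        ereal (f \<sigma>) * (ext_ln (f \<sigma>) - (\<Sum>\<tau>\<in>set_pmf \<mu>. ereal (P \<sigma> \<tau>) * ext_ln (f \<tau>))) * ereal (pmf \<mu> \<sigma>))"

text \<open>The convention \<open>0 log 0 = 0\<close> is built in, as \<open>0 * ln 0 = (0::real)\<close>.\<close>

definition entropy_of :: "'a pmf \<Rightarrow> ('a \<Rightarrow> real) \<Rightarrow> real" where
  "entropy_of \<mu> f =
     measure_pmf.expectation \<mu> (\<lambda>\<sigma>. f \<sigma> * ln (f \<sigma>))
     - measure_pmf.expectation \<mu> f * ln (measure_pmf.expectation \<mu> f)"

text \<open>
  Both functionals depend only on \<open>f\<close> restricted to \<open>set_pmf \<mu>\<close>, so \<open>f\<close> may be taken to be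
  defined on all configurations. The infimum of the empty set of extended reals is \<open>\<infinity>\<close>.
\<close>

definition mlsi_glauber :: "'v::finite config pmf \<Rightarrow> ereal" where
  "mlsi_glauber \<mu> =
     Inf {dirichlet_form_ln \<mu> (glauber \<mu>) f / ereal (entropy_of \<mu> f) | f.
            f \<in> set_pmf \<mu> \<rightarrow> {0..} \<and> entropy_of \<mu> f \<noteq> 0}"

text \<open>The infimum is over a finite nonempty family, hence a minimum.\<close>

definition mlsi_glauber_min :: "'v::finite config pmf \<Rightarrow> ereal" where
  "mlsi_glauber_min \<pi> =
     (INF \<Lambda>\<in>{\<Lambda>. \<Lambda> \<subset> UNIV}. INF \<sigma>\<in>set_pmf (marginal \<pi> \<Lambda>). mlsi_glauber (pin \<pi> \<Lambda> \<sigma>))"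

end

theory Submission
  imports Defs
begin

text \<open>
  Sample \<open>\<sigma>\<close> from \<open>\<mu>\<close> and let \<open>S\<close> contain each vertex with \<open>\<sigma>\<^sub>v = +1\<close> independently with
  probability \<open>1 - \<theta>\<close>. Given \<open>S\<close>, the law of \<open>\<sigma>\<close> is \<open>\<mu>\<^sup>(\<^sup>\<theta>\<^sup>)\<close> conditioned on \<open>S \<leftarrow> +1\<close>. Hence the claim
  follows once the expected Dirichlet form of this random measure is at most that of \<open>\<mu>\<close>, which
  is an elementary edgewise inequality, and its expected entropy is at least \<open>\<theta>\<^sup>\<eta>\<^sup>+\<^sup>1\<close> times that
  of \<open>\<mu>\<close>.

  For the latter, spectral independence with all fields bounds the covariance matrix of the
  \<open>+1\<close>-indicators by \<open>\<eta> + 1\<close> times the diagonal matrix of their means, for every field and, in the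
  limit of infinite fields, for every pinning to \<open>+1\<close>. So \<open>z \<mapsto> log (\<Sum>\<^sub>\<sigma> \<mu>(\<sigma>) \<Prod>\<^sub>v z\<^sub>v\<^sup>1\<^sup>/\<^sup>(\<^sup>\<eta>\<^sup>+\<^sup>1\<^sup>))\<close>
  (the product over \<open>\<sigma>\<^sub>v = +1\<close>) is concave, and its tangent at \<open>1\<close> together with the Gibbs
  variational principle bounds the entropy lost per unit of time when the pinning
  probability increases. Integrating this differential inequality from \<open>1\<close> down to \<open>\<theta>\<close> gives the
  factor \<open>\<theta>\<^sup>\<eta>\<^sup>+\<^sup>1 \<ge> (\<theta>/e)\<^sup>\<eta>\<^sup>+\<^sup>3\<close>.
\<close>

subsection \<open>Covariance bounds and the log-partition function\<close>

text \<open>Weights are left unnormalised, so that pinning and limits of fields need no division.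
  For \<open>w = pmf \<mu>\<close> this is \<open>field_weight\<close>.\<close>

definition tilt :: "('v::finite config \<Rightarrow> real) \<Rightarrow> ('v \<Rightarrow> real) \<Rightarrow> 'v config \<Rightarrow> real" where
  "tilt w lam \<sigma> = w \<sigma> * (\<Prod>v | \<sigma> v. lam v)"

definition mass :: "('v::finite config \<Rightarrow> real) \<Rightarrow> real" where
  "mass w = (\<Sum>\<sigma>\<in>UNIV. w \<sigma>)"

definition plus_weight :: "('v::finite config \<Rightarrow> real) \<Rightarrow> 'v \<Rightarrow> real" where
  "plus_weight w v = (\<Sum>\<sigma>\<in>UNIV. w \<sigma> * of_bool (\<sigma> v))"

definition plus_weight2 :: "('v::finite config \<Rightarrow> real) \<Rightarrow> 'v \<Rightarrow> 'v \<Rightarrow> real" where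
  "plus_weight2 w u v = (\<Sum>\<sigma>\<in>UNIV. w \<sigma> * (of_bool (\<sigma> u) * of_bool (\<sigma> v)))"

text \<open>After division by \<open>(mass w)\<^sup>2\<close> this bounds each absolute row sum of
  the covariance matrix of the \<open>+1\<close>-indicators by \<open>K\<close> times the mean of
  that row's indicator. The division-free form is homogeneous in \<open>w\<close> and passes to
  limits.\<close>

definition cov_bounded :: "real \<Rightarrow> ('v::finite config \<Rightarrow> real) \<Rightarrow> bool" where
  "cov_bounded K w \<longleftrightarrow>
     (\<forall>u. (\<Sum>v\<in>UNIV. \<bar>mass w * plus_weight2 w u v - plus_weight w u * plus_weight w v\<bar>)
          \<le> K * plus_weight w u * mass w)"

lemma tilt_nonneg: "(\<And>\<sigma>. 0 \<le> w \<sigma>) \<Longrightarrow> (\<And>v. 0 < lam v) \<Longrightarrow> 0 \<le> tilt w lam \<sigma>"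
  unfolding tilt_def by (intro mult_nonneg_nonneg prod_nonneg) (auto intro: less_imp_le)

lemma mass_pos_iff:
  assumes "\<And>\<sigma>. 0 \<le> w \<sigma>"
  shows "0 < mass w \<longleftrightarrow> (\<exists>\<sigma>. 0 < w \<sigma>)"
proof (rule iffI, rule ccontr)
  assume "0 < mass w" "\<not> (\<exists>\<sigma>. 0 < w \<sigma>)"
  moreover from this have "mass w \<le> 0" unfolding mass_def by (intro sum_nonpos) (auto simp: not_less)
  ultimately show False by simp
qed (auto simp: mass_def intro!: sum_pos2 assms)

lemma mass_tilt_pos:
  assumes "\<And>\<sigma>. 0 \<le> w \<sigma>" "\<And>v. 0 < lam v" "0 < mass w"
  shows "0 < mass (tilt w lam)"
proof -
  obtain \<sigma> where "0 < w \<sigma>" using assms mass_pos_iff by blast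
  then have "0 < tilt w lam \<sigma>" unfolding tilt_def by (intro mult_pos_pos prod_pos) (auto simp: assms)
  then show ?thesis using mass_pos_iff[of "tilt w lam"] tilt_nonneg[of w lam] assms by blast
qed

lemma mass_pos_of_weighted_sum:
  fixes w f :: "'v::finite config \<Rightarrow> real"
  assumes "\<And>\<sigma>. 0 \<le> w \<sigma>" "0 < (\<Sum>\<sigma>\<in>UNIV. w \<sigma> * f \<sigma>)"
  shows "0 < mass w"
proof (rule ccontr)
  assume "\<not> 0 < mass w"
  then have *: "\<not> 0 < w \<sigma>" for \<sigma> using mass_pos_iff[of w] assms(1) by blast
  have "w \<sigma> = 0" for \<sigma> using *[of \<sigma>] assms(1)[of \<sigma>] by simp
  with assms(2) show False by simp
qed

text \<open>The left-hand side is \<open>(mass w)\<^sup>2\<close> times a variance, that is, the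
  quadratic form of the symmetric matrix \<open>C\<close>. Row sums control it by the Schur test:
  bound \<open>x u * x v\<close> by \<open>((x u)\<^sup>2 + (x v)\<^sup>2) / 2\<close> and use
  symmetry.\<close>

lemma variance_bound:
  fixes w :: "'v::finite config \<Rightarrow> real" and x :: "'v \<Rightarrow> real"
  assumes "cov_bounded K w"
  shows "mass w * (\<Sum>\<sigma>\<in>UNIV. w \<sigma> * (\<Sum>v\<in>UNIV. x v * of_bool (\<sigma> v))\<^sup>2)
           - (\<Sum>\<sigma>\<in>UNIV. w \<sigma> * (\<Sum>v\<in>UNIV. x v * of_bool (\<sigma> v)))\<^sup>2
         \<le> K * mass w * (\<Sum>v\<in>UNIV. (x v)\<^sup>2 * plus_weight w v)"
proof -
  define C where "C u v = mass w * plus_weight2 w u v - plus_weight w u * plus_weight w v" for u v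
  have sym: "C u v = C v u" for u v
    by (simp add: C_def plus_weight2_def mult.commute)
  have "(\<Sum>\<sigma>\<in>UNIV. w \<sigma> * (\<Sum>v\<in>UNIV. x v * of_bool (\<sigma> v))\<^sup>2)
      = (\<Sum>\<sigma>\<in>UNIV. \<Sum>u\<in>UNIV. \<Sum>v\<in>UNIV. x u * x v * (w \<sigma> * (of_bool (\<sigma> u) * of_bool (\<sigma> v))))"
    unfolding power2_eq_square sum_product unfolding sum_distrib_left by (intro sum.cong refl) (simp only: mult_ac)
  also have "\<dots> = (\<Sum>u\<in>UNIV. \<Sum>\<sigma>\<in>UNIV. \<Sum>v\<in>UNIV. x u * x v * (w \<sigma> * (of_bool (\<sigma> u) * of_bool (\<sigma> v))))"
    by (rule sum.swap)
  also have "\<dots> = (\<Sum>u\<in>UNIV. \<Sum>v\<in>UNIV. \<Sum>\<sigma>\<in>UNIV. x u * x v * (w \<sigma> * (of_bool (\<sigma> u) * of_bool (\<sigma> v))))"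
    by (intro sum.cong refl sum.swap)
  also have "\<dots> = (\<Sum>u\<in>UNIV. \<Sum>v\<in>UNIV. x u * x v * plus_weight2 w u v)"
    by (simp only: plus_weight2_def sum_distrib_left)
  finally have 1: "(\<Sum>\<sigma>\<in>UNIV. w \<sigma> * (\<Sum>v\<in>UNIV. x v * of_bool (\<sigma> v))\<^sup>2)
      = (\<Sum>u\<in>UNIV. \<Sum>v\<in>UNIV. x u * x v * plus_weight2 w u v)" .
  have 2: "(\<Sum>\<sigma>\<in>UNIV. w \<sigma> * (\<Sum>v\<in>UNIV. x v * of_bool (\<sigma> v))) = (\<Sum>v\<in>UNIV. x v * plus_weight w v)"
    unfolding plus_weight_def sum_distrib_left by (subst sum.swap) (simp only: mult_ac)
  have "mass w * (\<Sum>\<sigma>\<in>UNIV. w \<sigma> * (\<Sum>v\<in>UNIV. x v * of_bool (\<sigma> v))\<^sup>2)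
           - (\<Sum>\<sigma>\<in>UNIV. w \<sigma> * (\<Sum>v\<in>UNIV. x v * of_bool (\<sigma> v)))\<^sup>2
        = (\<Sum>u\<in>UNIV. \<Sum>v\<in>UNIV. x u * x v * C u v)"
    unfolding 1 2 unfolding power2_eq_square sum_product
    unfolding sum_distrib_left C_def sum_subtractf[symmetric]
    by (intro sum.cong refl) (simp add: algebra_simps)
  also have "\<dots> \<le> (\<Sum>u\<in>UNIV. \<Sum>v\<in>UNIV. ((x u)\<^sup>2 / 2 + (x v)\<^sup>2 / 2) * \<bar>C u v\<bar>)"
  proof (intro sum_mono)
    fix u v
    have "x u * x v * C u v \<le> \<bar>x u * x v\<bar> * \<bar>C u v\<bar>" by (metis abs_ge_self abs_mult)
    also have "\<dots> \<le> ((x u)\<^sup>2 / 2 + (x v)\<^sup>2 / 2) * \<bar>C u v\<bar>"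
      using sum_squares_bound[of "\<bar>x u\<bar>" "\<bar>x v\<bar>"] by (intro mult_right_mono) (auto simp: abs_mult)
    finally show "x u * x v * C u v \<le> ((x u)\<^sup>2 / 2 + (x v)\<^sup>2 / 2) * \<bar>C u v\<bar>" .
  qed
  also have "\<dots> = (\<Sum>u\<in>UNIV. \<Sum>v\<in>UNIV. (x u)\<^sup>2 / 2 * \<bar>C u v\<bar>) + (\<Sum>u\<in>UNIV. \<Sum>v\<in>UNIV. (x v)\<^sup>2 / 2 * \<bar>C u v\<bar>)"
    by (simp add: distrib_right sum.distrib)
  also have "(\<Sum>u\<in>UNIV. \<Sum>v\<in>UNIV. (x v)\<^sup>2 / 2 * \<bar>C u v\<bar>) = (\<Sum>u\<in>UNIV. \<Sum>v\<in>UNIV. (x u)\<^sup>2 / 2 * \<bar>C u v\<bar>)"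
    by (subst sum.swap) (simp add: sym)
  also have "(\<Sum>u\<in>UNIV. \<Sum>v\<in>UNIV. (x u)\<^sup>2 / 2 * \<bar>C u v\<bar>) + (\<Sum>u\<in>UNIV. \<Sum>v\<in>UNIV. (x u)\<^sup>2 / 2 * \<bar>C u v\<bar>)
      = (\<Sum>u\<in>UNIV. (x u)\<^sup>2 * (\<Sum>v\<in>UNIV. \<bar>C u v\<bar>))"
    unfolding sum_distrib_left sum.distrib[symmetric] by (intro sum.cong refl) (simp add: field_simps)
  also have "\<dots> \<le> (\<Sum>u\<in>UNIV. (x u)\<^sup>2 * (K * plus_weight w u * mass w))"
    using assms by (intro sum_mono mult_left_mono) (auto simp: cov_bounded_def C_def)
  finally show ?thesis by (simp add: sum_distrib_left mult_ac)
qed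

text \<open>The field \<open>exp (ln (z v) / K)\<close> is \<open>z v\<close> to the power
  \<open>1 / K\<close>, and the right-hand side is the derivative of the log-partition function at
  \<open>1\<close> in direction \<open>z - 1\<close>. The curvature contributed by the power
  \<open>1 / K\<close> absorbs the variance that \<open>cov_bounded K\<close> allows.\<close>

lemma log_partition_tangent_bound:
  fixes w :: "'v::finite config \<Rightarrow> real" and z :: "'v \<Rightarrow> real"
  assumes w: "\<And>\<sigma>. 0 \<le> w \<sigma>" "0 < mass w" and K: "K > 0"
    and cov: "\<And>lam. (\<And>v. 0 < lam v) \<Longrightarrow> cov_bounded K (tilt w lam)"
    and z: "\<And>v. 0 < z v"
  shows "ln (mass (tilt w (\<lambda>v. exp (ln (z v) / K))) / mass w)
         \<le> (\<Sum>v\<in>UNIV. plus_weight w v * (z v - 1)) / (K * mass w)"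
proof -
  \<comment> \<open>The logarithm of the partition function is concave along the segment from \<open>1\<close> to \<open>z\<close>.\<close>
  define c where "c s v = 1 + s * (z v - 1)" for s v
  have c: "0 < c s v" if "0 \<le> s" "s \<le> 1" for s v
  proof -
    have "c s v = (1 - s) + s * z v" by (simp add: c_def algebra_simps)
    also have "\<dots> > 0" using that z[of v] by (cases "s = 0") (auto intro!: add_nonneg_pos)
    finally show ?thesis .
  qed
  define lam where "lam s v = exp (ln (c s v) / K)" for s v
  define x where "x s v = (z v - 1) / (c s v * K)" for s v
  define B where "B s \<sigma> = (\<Sum>v\<in>UNIV. x s v * of_bool (\<sigma> v))" for s \<sigma>
  define A where "A s \<sigma> = (\<Sum>v\<in>UNIV. ln (c s v) / K * of_bool (\<sigma> v))" for s \<sigma>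
  define W where "W s = (\<Sum>\<sigma>\<in>UNIV. w \<sigma> * exp (A s \<sigma>))" for s
  define W1 where "W1 s = (\<Sum>\<sigma>\<in>UNIV. w \<sigma> * exp (A s \<sigma>) * B s \<sigma>)" for s
  \<comment> \<open>\<open>W1\<close> and \<open>W2\<close> are the first two derivatives of
    \<open>W\<close>. The term with \<open>K\<close> comes from differentiating \<open>B\<close>,
    since the derivative of \<open>x s v\<close> is \<open>- K * (x s v)\<^sup>2\<close>.\<close>
  define W2 where "W2 s = (\<Sum>\<sigma>\<in>UNIV. w \<sigma> * exp (A s \<sigma>) * ((B s \<sigma>)\<^sup>2 - K * (\<Sum>v\<in>UNIV. (x s v)\<^sup>2 * of_bool (\<sigma> v))))" for s
  have tilt_eq: "tilt w (lam s) \<sigma> = w \<sigma> * exp (A s \<sigma>)" for s \<sigma>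
  proof -
    have "A s \<sigma> = (\<Sum>v | \<sigma> v. ln (c s v) / K)"
      unfolding A_def by (rule sum.mono_neutral_cong_right) auto
    then show ?thesis by (simp add: tilt_def lam_def exp_sum)
  qed
  have W_eq: "W s = mass (tilt w (lam s))" for s
    by (simp add: W_def mass_def tilt_eq)
  have Wpos: "W s > 0" for s
    unfolding W_eq using w by (intro mass_tilt_pos) (auto simp: lam_def)
  have dc: "((\<lambda>s. c s v) has_real_derivative z v - 1) (at s)" for s v
    unfolding c_def by (auto intro!: derivative_eq_intros)
  have dA: "((\<lambda>s. A s \<sigma>) has_real_derivative B s \<sigma>) (at s)" if "0 \<le> s" "s \<le> 1" for s \<sigma>
    unfolding A_def B_def
  proof (rule DERIV_sum)
    fix v
    show "((\<lambda>s. ln (c s v) / K * of_bool (\<sigma> v)) has_real_derivative x s v * of_bool (\<sigma> v)) (at s)"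
      using c[OF that, of v] K unfolding x_def
      by (auto intro!: derivative_eq_intros dc simp: field_simps)
  qed
  have dB: "((\<lambda>s. B s \<sigma>) has_real_derivative - K * (\<Sum>v\<in>UNIV. (x s v)\<^sup>2 * of_bool (\<sigma> v))) (at s)"
    if "0 \<le> s" "s \<le> 1" for s \<sigma>
    unfolding B_def sum_distrib_left
  proof (rule DERIV_sum)
    fix v
    show "((\<lambda>s. x s v * of_bool (\<sigma> v)) has_real_derivative - K * ((x s v)\<^sup>2 * of_bool (\<sigma> v))) (at s)"
      using c[OF that, of v] K unfolding x_def
      by (auto intro!: derivative_eq_intros dc simp: field_simps power2_eq_square)
  qed
  have dW: "(W has_real_derivative W1 s) (at s)" if "0 \<le> s" "s \<le> 1" for s
    unfolding W_def W1_def
    by (rule DERIV_sum) (auto intro!: derivative_eq_intros dA[OF that] simp: algebra_simps)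
  have dW1: "(W1 has_real_derivative W2 s) (at s)" if "0 \<le> s" "s \<le> 1" for s
    unfolding W1_def W2_def
    by (rule DERIV_sum)
      (auto intro!: derivative_eq_intros dA[OF that] dB[OF that] simp: algebra_simps power2_eq_square)
  \<comment> \<open>This is the sign of the second derivative of \<open>ln (W s)\<close>, whose
    numerator is \<open>W2 s * W s - (W1 s)\<^sup>2\<close>: the \<open>K\<close>-term inside
    \<open>W2\<close> matches the bound of \<open>variance_bound\<close> exactly.\<close>
  have W2_le: "W2 s * W s \<le> (W1 s)\<^sup>2" for s
  proof -
    have "cov_bounded K (tilt w (lam s))" by (rule cov) (simp add: lam_def)
    from variance_bound[OF this, of "x s"]
    have "W s * (\<Sum>\<sigma>\<in>UNIV. w \<sigma> * exp (A s \<sigma>) * (B s \<sigma>)\<^sup>2) - (W1 s)\<^sup>2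
        \<le> W s * (K * (\<Sum>v\<in>UNIV. (x s v)\<^sup>2 * plus_weight (tilt w (lam s)) v))"
      unfolding W_eq[symmetric] tilt_eq B_def[symmetric] W1_def by (simp add: mult_ac)
    also have "K * (\<Sum>v\<in>UNIV. (x s v)\<^sup>2 * plus_weight (tilt w (lam s)) v)
        = (\<Sum>\<sigma>\<in>UNIV. w \<sigma> * exp (A s \<sigma>) * (K * (\<Sum>v\<in>UNIV. (x s v)\<^sup>2 * of_bool (\<sigma> v))))"
      unfolding plus_weight_def tilt_eq sum_distrib_left by (subst sum.swap) (simp add: mult_ac)
    finally show ?thesis
      unfolding W2_def by (simp add: right_diff_distrib sum_subtractf algebra_simps)
  qed
  have dln: "((\<lambda>s. ln (W s)) has_real_derivative W1 s / W s) (at s)" if "0 \<le> s" "s \<le> 1" for s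
    using dW[OF that] Wpos[of s] by (auto intro!: derivative_eq_intros)
  have dq: "((\<lambda>s. W1 s / W s) has_real_derivative (W2 s * W s - W1 s * W1 s) / (W s * W s)) (at s)"
    if "0 \<le> s" "s \<le> 1" for s
    using dW[OF that] dW1[OF that] Wpos[of s] by (intro DERIV_divide) auto
  \<comment> \<open>The increment of \<open>ln (W s)\<close> over the unit interval is its slope at
    some \<open>\<xi>\<close>; slopes do not increase, so the slope at \<open>0\<close> bounds
    it.\<close>
  obtain \<xi> where \<xi>: "0 < \<xi>" "\<xi> < 1" "ln (W 1) - ln (W 0) = (1 - 0) * (W1 \<xi> / W \<xi>)"
    using MVT2[of 0 1 "\<lambda>s. ln (W s)" "\<lambda>s. W1 s / W s"] dln by auto
  have "W1 \<xi> / W \<xi> \<le> W1 0 / W 0"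
  proof (rule DERIV_nonpos_imp_nonincreasing[of 0 \<xi> "\<lambda>s. W1 s / W s"])
    fix s assume "0 \<le> s" "s \<le> \<xi>"
    then have "0 \<le> s" "s \<le> 1" using \<xi> by auto
    moreover have "(W2 s * W s - W1 s * W1 s) / (W s * W s) \<le> 0"
      using W2_le[of s] Wpos[of s] by (intro divide_nonpos_pos) (auto simp: power2_eq_square)
    ultimately show "\<exists>y. ((\<lambda>s. W1 s / W s) has_real_derivative y) (at s) \<and> y \<le> 0" using dq by blast
  qed (use \<xi> in auto)
  moreover have "W 0 = mass w" by (simp add: W_def A_def c_def mass_def)
  moreover have "W1 0 = (\<Sum>v\<in>UNIV. plus_weight w v * (z v - 1)) / K"
    unfolding W1_def A_def B_def c_def x_def plus_weight_def sum_distrib_left sum_distrib_right sum_divide_distrib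
    by (subst sum.swap) (simp add: field_simps)
  moreover have "W 1 = mass (tilt w (\<lambda>v. exp (ln (z v) / K)))"
    by (simp add: W_eq lam_def[abs_def] c_def)
  ultimately show ?thesis using \<xi> Wpos[of 1] w
    by (simp add: ln_div)
qed

subsection \<open>Entropic stability\<close>

text \<open>For a weight of positive mass, this is \<open>mass w\<close> times the entropy of
  \<open>f\<close> under the normalised weight. In this scaling the entropies of the pinnings
  average with the weights \<open>(1 - t) ^ card S\<close>.\<close>

definition weighted_ent :: "('v::finite config \<Rightarrow> real) \<Rightarrow> ('v config \<Rightarrow> real) \<Rightarrow> real" where
  "weighted_ent w f = (\<Sum>\<sigma>\<in>UNIV. w \<sigma> * (f \<sigma> * ln (f \<sigma>)))
     - (\<Sum>\<sigma>\<in>UNIV. w \<sigma> * f \<sigma>) * ln ((\<Sum>\<sigma>\<in>UNIV. w \<sigma> * f \<sigma>) / mass w)"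

text \<open>The Donsker-Varadhan bound: apply \<open>ln x \<le> x - 1\<close> with
  \<open>x = exp (g \<sigma>) / f \<sigma> * (a / Y)\<close> and weight by
  \<open>w \<sigma> * f \<sigma>\<close>. The factor \<open>a / Y\<close> makes the right-hand sides
  sum to zero.\<close>

lemma gibbs_variational:
  fixes w f g :: "'v::finite config \<Rightarrow> real"
  assumes w: "\<And>\<sigma>. 0 \<le> w \<sigma>" and f: "\<And>\<sigma>. 0 < w \<sigma> \<Longrightarrow> 0 \<le> f \<sigma>"
    and a: "0 < (\<Sum>\<sigma>\<in>UNIV. w \<sigma> * f \<sigma>)"
  shows "(\<Sum>\<sigma>\<in>UNIV. w \<sigma> * f \<sigma> * g \<sigma>)
         - (\<Sum>\<sigma>\<in>UNIV. w \<sigma> * f \<sigma>) * ln ((\<Sum>\<sigma>\<in>UNIV. w \<sigma> * exp (g \<sigma>)) / mass w) \<le> weighted_ent w f"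
proof -
  define a where "a = (\<Sum>\<sigma>\<in>UNIV. w \<sigma> * f \<sigma>)"
  define b where "b = mass w"
  define Y where "Y = (\<Sum>\<sigma>\<in>UNIV. w \<sigma> * exp (g \<sigma>))"
  have b: "0 < b" unfolding b_def using mass_pos_of_weighted_sum[OF w a] .
  then obtain \<sigma>0 where \<sigma>0: "0 < w \<sigma>0" unfolding b_def using mass_pos_iff[of w] w by blast
  have Y: "0 < Y" unfolding Y_def using \<sigma>0 w by (intro sum_pos2[of _ \<sigma>0]) auto
  have a: "0 < a" using a by (simp add: a_def)
  have "(\<Sum>\<sigma>\<in>UNIV. w \<sigma> * f \<sigma> * (g \<sigma> - ln (f \<sigma>) + ln (a / Y))) \<le> (\<Sum>\<sigma>\<in>UNIV. a / Y * (w \<sigma> * exp (g \<sigma>)) - w \<sigma> * f \<sigma>)"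
  proof (rule sum_mono)
    fix \<sigma>
    show "w \<sigma> * f \<sigma> * (g \<sigma> - ln (f \<sigma>) + ln (a / Y)) \<le> a / Y * (w \<sigma> * exp (g \<sigma>)) - w \<sigma> * f \<sigma>"
    proof (cases "w \<sigma> = 0 \<or> f \<sigma> = 0")
      case True
      then show ?thesis using w[of \<sigma>] a Y by auto
    next
      case False
      then have wp: "0 < w \<sigma>" using w[of \<sigma>] by auto
      then have fp: "0 < f \<sigma>" using f[OF wp] False by auto
      have "g \<sigma> - ln (f \<sigma>) + ln (a / Y) = ln (exp (g \<sigma>) / f \<sigma> * (a / Y))"
        using fp a Y by (simp add: ln_mult ln_div)
      also have "\<dots> \<le> exp (g \<sigma>) / f \<sigma> * (a / Y) - 1" using fp a Y by (intro ln_le_minus_one) auto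
      finally have "w \<sigma> * f \<sigma> * (g \<sigma> - ln (f \<sigma>) + ln (a / Y)) \<le> w \<sigma> * f \<sigma> * (exp (g \<sigma>) / f \<sigma> * (a / Y) - 1)"
        using wp fp by (intro mult_left_mono) auto
      also have "\<dots> = a / Y * (w \<sigma> * exp (g \<sigma>)) - w \<sigma> * f \<sigma>" using fp by (simp add: field_simps)
      finally show ?thesis .
    qed
  qed
  also have "\<dots> = a / Y * Y - a" by (simp add: sum_subtractf a_def Y_def sum_distrib_left)
  also have "\<dots> = 0" using Y by simp
  finally have "(\<Sum>\<sigma>\<in>UNIV. w \<sigma> * f \<sigma> * g \<sigma>) - (\<Sum>\<sigma>\<in>UNIV. w \<sigma> * (f \<sigma> * ln (f \<sigma>))) + a * ln (a / Y) \<le> 0"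
    by (simp add: distrib_left right_diff_distrib sum.distrib sum_subtractf a_def sum_distrib_right mult.assoc)
  moreover have "ln (a / Y) = ln (a / b) - ln (Y / b)" using a b Y by (simp add: ln_div)
  ultimately show ?thesis
    unfolding weighted_ent_def a_def[symmetric] b_def[symmetric] Y_def[symmetric] by (simp add: algebra_simps)
qed

lemma weighted_ent_nonneg:
  fixes w f :: "'v::finite config \<Rightarrow> real"
  assumes w: "\<And>\<sigma>. 0 \<le> w \<sigma>" and f: "\<And>\<sigma>. 0 < w \<sigma> \<Longrightarrow> 0 \<le> f \<sigma>"
  shows "0 \<le> weighted_ent w f"
proof -
  have nn: "0 \<le> w \<sigma> * f \<sigma>" for \<sigma> using w[of \<sigma>] f[of \<sigma>] by (cases "w \<sigma> = 0") auto
  show ?thesis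
  proof (cases "(\<Sum>\<sigma>\<in>UNIV. w \<sigma> * f \<sigma>) = 0")
    case True
    then have z: "w \<sigma> * f \<sigma> = 0" for \<sigma> using nn by (simp add: sum_nonneg_eq_0_iff)
    have "w \<sigma> * (f \<sigma> * ln (f \<sigma>)) = 0" for \<sigma> using z[of \<sigma>] by auto
    then have "(\<Sum>\<sigma>\<in>UNIV. w \<sigma> * (f \<sigma> * ln (f \<sigma>))) = 0" by (intro sum.neutral) blast
    with True show ?thesis by (simp add: weighted_ent_def)
  next
    case False
    then have "0 < (\<Sum>\<sigma>\<in>UNIV. w \<sigma> * f \<sigma>)" using nn by (simp add: order_less_le sum_nonneg)
    from gibbs_variational[where g="\<lambda>_. 0", OF w f this] show ?thesis
      by (cases "mass w = 0") (auto simp: mass_def)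
  qed
qed

text \<open>The left-hand side is the unnormalised relative entropy of \<open>q\<close> with respect
  to \<open>h * p\<close>. It arises from \<open>gibbs_variational\<close> with the logarithm of a
  product field as test function: the partition function is bounded by its tangent, and the field is
  then optimised.\<close>

lemma entropic_stability:
  fixes w f :: "'v::finite config \<Rightarrow> real"
  assumes w: "\<And>\<sigma>. 0 \<le> w \<sigma>" and f: "\<And>\<sigma>. 0 < w \<sigma> \<Longrightarrow> 0 \<le> f \<sigma>" and K: "K > 0"
    and cov: "\<And>lam. (\<And>v. 0 < lam v) \<Longrightarrow> cov_bounded K (tilt w lam)"
    and apos: "0 < (\<Sum>\<sigma>\<in>UNIV. w \<sigma> * f \<sigma>)"
  defines "p \<equiv> plus_weight w" and "q \<equiv> plus_weight (\<lambda>\<sigma>. w \<sigma> * f \<sigma>)"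
    and "h \<equiv> (\<Sum>\<sigma>\<in>UNIV. w \<sigma> * f \<sigma>) / mass w"
  shows "(\<Sum>v\<in>UNIV. q v * ln (q v / p v / h) - q v + p v * h) \<le> K * weighted_ent w f"
proof -
  define a where "a = (\<Sum>\<sigma>\<in>UNIV. w \<sigma> * f \<sigma>)"
  have b: "0 < mass w" using mass_pos_of_weighted_sum[OF w apos] .
  have a: "0 < a" using apos by (simp add: a_def)
  have h: "0 < h" "a = h * mass w" using a b by (auto simp: h_def a_def)
  have nn: "0 \<le> w \<sigma> * f \<sigma>" for \<sigma> using w[of \<sigma>] f[of \<sigma>] by (cases "w \<sigma> = 0") auto
  have p0: "0 \<le> p v" and q0: "0 \<le> q v" for v
    unfolding p_def q_def plus_weight_def using w nn by (auto intro!: sum_nonneg)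
  have qp: "0 < p v" if "0 < q v" for v
  proof (rule ccontr)
    assume "\<not> 0 < p v"
    then have "p v = 0" using p0[of v] by simp
    then have "\<forall>\<sigma>. w \<sigma> * of_bool (\<sigma> v) = 0"
      unfolding p_def plus_weight_def using w by (subst (asm) sum_nonneg_eq_0_iff) auto
    then have "q v = 0" unfolding q_def plus_weight_def by (intro sum.neutral) auto
    with that show False by simp
  qed
  \<comment> \<open>The optimal field is \<open>q v / p v / h\<close>; where it vanishes, use \<open>\<epsilon>\<close> and let \<open>\<epsilon> \<rightarrow> 0\<close>.\<close>
  define Z where "Z \<epsilon> v = (if 0 < q v then q v / p v / h else \<epsilon>)" for \<epsilon> v
  have main: "(\<Sum>v\<in>UNIV. q v * ln (Z \<epsilon> v) - h * (p v * (Z \<epsilon> v - 1))) \<le> K * weighted_ent w f" if \<epsilon>: "0 < \<epsilon>" for \<epsilon>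
  proof -
    have Zp: "0 < Z \<epsilon> v" for v using qp h \<epsilon> by (auto simp: Z_def)
    define g where "g \<sigma> = (\<Sum>v\<in>UNIV. ln (Z \<epsilon> v) / K * of_bool (\<sigma> v))" for \<sigma>
    have tilt_eq: "tilt w (\<lambda>v. exp (ln (Z \<epsilon> v) / K)) \<sigma> = w \<sigma> * exp (g \<sigma>)" for \<sigma>
    proof -
      have "g \<sigma> = (\<Sum>v | \<sigma> v. ln (Z \<epsilon> v) / K)"
        unfolding g_def by (rule sum.mono_neutral_cong_right) auto
      then show ?thesis by (simp add: tilt_def exp_sum)
    qed
    have "ln ((\<Sum>\<sigma>\<in>UNIV. w \<sigma> * exp (g \<sigma>)) / mass w) \<le> (\<Sum>v\<in>UNIV. p v * (Z \<epsilon> v - 1)) / (K * mass w)"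
      using log_partition_tangent_bound[OF w b K cov, of "Z \<epsilon>"] Zp
      unfolding mass_def[of "tilt _ _"] tilt_eq p_def by simp
    then have "a * ln ((\<Sum>\<sigma>\<in>UNIV. w \<sigma> * exp (g \<sigma>)) / mass w) \<le> a * ((\<Sum>v\<in>UNIV. p v * (Z \<epsilon> v - 1)) / (K * mass w))"
      using a by (intro mult_left_mono) auto
    also have "\<dots> = (\<Sum>v\<in>UNIV. h * (p v * (Z \<epsilon> v - 1))) / K"
      using b K unfolding h(2) by (simp flip: sum_distrib_left)
    finally have 1: "a * ln ((\<Sum>\<sigma>\<in>UNIV. w \<sigma> * exp (g \<sigma>)) / mass w) \<le> (\<Sum>v\<in>UNIV. h * (p v * (Z \<epsilon> v - 1))) / K" .
    have 2: "(\<Sum>\<sigma>\<in>UNIV. w \<sigma> * f \<sigma> * g \<sigma>) = (\<Sum>v\<in>UNIV. q v * ln (Z \<epsilon> v)) / K"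
      unfolding g_def q_def plus_weight_def sum_distrib_left sum_distrib_right sum_divide_distrib
      by (subst sum.swap) (simp add: mult_ac)
    have "(\<Sum>v\<in>UNIV. q v * ln (Z \<epsilon> v)) / K - (\<Sum>v\<in>UNIV. h * (p v * (Z \<epsilon> v - 1))) / K \<le> weighted_ent w f"
      using gibbs_variational[where g=g, OF w f apos] 1 unfolding 2 a_def[symmetric] by linarith
    then have "((\<Sum>v\<in>UNIV. q v * ln (Z \<epsilon> v)) - (\<Sum>v\<in>UNIV. h * (p v * (Z \<epsilon> v - 1)))) / K \<le> weighted_ent w f"
      by (simp only: diff_divide_distrib)
    then show ?thesis using K by (simp add: sum_subtractf pos_divide_le_eq mult.commute)
  qed
  have lim: "((\<lambda>\<epsilon>. \<Sum>v\<in>UNIV. q v * ln (Z \<epsilon> v) - h * (p v * (Z \<epsilon> v - 1)))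
          \<longlongrightarrow> (\<Sum>v\<in>UNIV. q v * ln (q v / p v / h) - q v + p v * h)) (at_right 0)"
  proof (rule tendsto_sum)
    fix v
    show "((\<lambda>\<epsilon>. q v * ln (Z \<epsilon> v) - h * (p v * (Z \<epsilon> v - 1)))
          \<longlongrightarrow> q v * ln (q v / p v / h) - q v + p v * h) (at_right 0)"
    proof (cases "0 < q v")
      case True
      then show ?thesis using qp[OF True] h by (simp add: Z_def algebra_simps)
    next
      case False
      then have "q v = 0" using q0[of v] by simp
      moreover have "((\<lambda>\<epsilon>. - (h * (p v * (\<epsilon> - 1)))) \<longlongrightarrow> - (h * (p v * (0 - 1)))) (at_right 0)"
        by (intro tendsto_intros)
      ultimately show ?thesis by (simp add: Z_def mult.commute)
    qed
  qed
  have ev: "\<forall>\<^sub>F \<epsilon> in at_right 0. (\<Sum>v\<in>UNIV. q v * ln (Z \<epsilon> v) - h * (p v * (Z \<epsilon> v - 1))) \<le> K * weighted_ent w f"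
    using main by (auto simp: eventually_at_filter)
  show ?thesis by (rule tendsto_upperbound[OF lim ev]) simp
qed

subsection \<open>Conservation of entropy under random pinning\<close>

lemma cov_bounded_scale:
  assumes "cov_bounded K w"
  shows "cov_bounded K (\<lambda>\<sigma>. c * w \<sigma>)"
proof -
  have [simp]: "mass (\<lambda>\<sigma>. c * w \<sigma>) = c * mass w" "plus_weight (\<lambda>\<sigma>. c * w \<sigma>) = (\<lambda>v. c * plus_weight w v)"
    "plus_weight2 (\<lambda>\<sigma>. c * w \<sigma>) = (\<lambda>u v. c * plus_weight2 w u v)"
    by (simp_all only: mass_def plus_weight_def[abs_def] plus_weight2_def[abs_def] sum_distrib_left mult.assoc)
  show ?thesis unfolding cov_bounded_def
  proof
    fix u
    have "(\<Sum>v\<in>UNIV. \<bar>c * mass w * (c * plus_weight2 w u v) - c * plus_weight w u * (c * plus_weight w v)\<bar>)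
       = c\<^sup>2 * (\<Sum>v\<in>UNIV. \<bar>mass w * plus_weight2 w u v - plus_weight w u * plus_weight w v\<bar>)"
      unfolding sum_distrib_left
    proof (intro sum.cong refl)
      fix v
      have "c * mass w * (c * plus_weight2 w u v) - c * plus_weight w u * (c * plus_weight w v)
          = c\<^sup>2 * (mass w * plus_weight2 w u v - plus_weight w u * plus_weight w v)"
        by (simp add: algebra_simps power2_eq_square)
      then show "\<bar>c * mass w * (c * plus_weight2 w u v) - c * plus_weight w u * (c * plus_weight w v)\<bar>
          = c\<^sup>2 * \<bar>mass w * plus_weight2 w u v - plus_weight w u * plus_weight w v\<bar>"
        by (simp add: abs_mult)
    qed
    also have "\<dots> \<le> c\<^sup>2 * (K * plus_weight w u * mass w)"
      using assms by (intro mult_left_mono) (auto simp: cov_bounded_def)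
    finally show "(\<Sum>v\<in>UNIV. \<bar>mass (\<lambda>\<sigma>. c * w \<sigma>) * plus_weight2 (\<lambda>\<sigma>. c * w \<sigma>) u v
        - plus_weight (\<lambda>\<sigma>. c * w \<sigma>) u * plus_weight (\<lambda>\<sigma>. c * w \<sigma>) v\<bar>)
      \<le> K * plus_weight (\<lambda>\<sigma>. c * w \<sigma>) u * mass (\<lambda>\<sigma>. c * w \<sigma>)"
      by (simp add: power2_eq_square mult_ac)
  qed
qed

text \<open>Both sides of the condition are continuous in the finitely many values
  \<open>w \<sigma>\<close>, so the condition is closed. This is how pinnings are reached as limits
  of fields.\<close>

lemma cov_bounded_tendsto:
  fixes w :: "'v::finite config \<Rightarrow> real"
  assumes "\<And>\<sigma>. ((\<lambda>r. W r \<sigma>) \<longlongrightarrow> w \<sigma>) F" "\<forall>\<^sub>F r in F. cov_bounded K (W r)" "F \<noteq> bot"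
  shows "cov_bounded K w"
  unfolding cov_bounded_def
proof
  fix u
  let ?L = "\<lambda>w::'v config \<Rightarrow> real. \<Sum>v\<in>UNIV. \<bar>mass w * plus_weight2 w u v - plus_weight w u * plus_weight w v\<bar>"
  let ?R = "\<lambda>w::'v config \<Rightarrow> real. K * plus_weight w u * mass w"
  show "?L w \<le> ?R w"
  proof (rule tendsto_le[OF assms(3)])
    show "((\<lambda>r. ?L (W r)) \<longlongrightarrow> ?L w) F" "((\<lambda>r. ?R (W r)) \<longlongrightarrow> ?R w) F"
      unfolding mass_def plus_weight_def plus_weight2_def by (intro tendsto_intros assms(1))+
    show "\<forall>\<^sub>F r in F. ?L (W r) \<le> ?R (W r)"
      using assms(2) by eventually_elim (auto simp: cov_bounded_def)
  qed
qed

text \<open>\<open>(1 - t)\<^bsup>|S|\<^esup> * pinned w S t \<sigma>\<close> is the joint weight of \<open>(\<sigma>, S)\<close> when \<open>S\<close> keeps each \<open>+1\<close> of \<open>\<sigma>\<close> with probability \<open>1 - t\<close>.\<close>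

definition pinned :: "('v::finite config \<Rightarrow> real) \<Rightarrow> 'v set \<Rightarrow> real \<Rightarrow> 'v config \<Rightarrow> real" where
  "pinned w S t \<sigma> = w \<sigma> * (of_bool (S \<subseteq> {v. \<sigma> v}) * t ^ card ({v. \<sigma> v} - S))"

lemma pinned_nonneg: "0 \<le> w \<sigma> \<Longrightarrow> 0 \<le> t \<Longrightarrow> 0 \<le> pinned w S t \<sigma>"
  by (simp add: pinned_def)

lemma pos_if_pinned_pos: "0 < pinned w S t \<sigma> \<Longrightarrow> 0 \<le> w \<sigma> \<Longrightarrow> 0 < w \<sigma>"
  by (cases "w \<sigma> = 0") (auto simp: pinned_def)

lemma cov_bounded_pinned:
  fixes w :: "'v::finite config \<Rightarrow> real"
  assumes cov: "\<And>lam. (\<And>v. 0 < lam v) \<Longrightarrow> cov_bounded K (tilt w lam)"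
    and t: "0 < t" and lam: "\<And>v. 0 < lam v"
  shows "cov_bounded K (tilt (pinned w S t) lam)"
  \<comment> \<open>Fields \<open>lam / r\<close> on \<open>S\<close>, normalised by \<open>r\<^bsup>|S|\<^esup>\<close>, converge to the pinning of \<open>S\<close> as \<open>r \<rightarrow> 0\<close>.\<close>
proof (rule cov_bounded_tendsto[where F = "at_right 0"])
  define W where "W r \<sigma> = r ^ card S * tilt w (\<lambda>v. lam v * (if v \<in> S then 1 / r else t)) \<sigma>" for r :: real and \<sigma>
  have "cov_bounded K (W r)" if "0 < r" for r
    unfolding W_def[abs_def] using that t lam by (intro cov_bounded_scale cov) auto
  then show "\<forall>\<^sub>F r in at_right 0. cov_bounded K (W r)" by (auto simp: eventually_at_filter)
  fix \<sigma> :: "'v config"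
  define A where "A = {v. \<sigma> v}"
  have W_eq: "W r \<sigma> = w \<sigma> * prod lam A * (r ^ card (S - A) * t ^ card (A - S))" if "0 < r" for r
  proof -
    have "(\<Prod>v\<in>A. lam v * (if v \<in> S then 1 / r else t)) = prod lam A * ((1 / r) ^ card (A \<inter> S) * t ^ card (A - S))"
      by (simp add: prod.distrib prod.If_cases Diff_eq)
    moreover have "r ^ card S * (1 / r) ^ card (A \<inter> S) = r ^ card (S - A)"
    proof -
      have "card S = card (S - A) + card (A \<inter> S)"
        by (metis card_Diff_subset_Int card_mono finite inf_commute inf_le1 le_add_diff_inverse2)
      then show ?thesis using that by (simp add: power_add power_one_over)
    qed
    ultimately show ?thesis by (simp add: W_def tilt_def A_def[symmetric] mult_ac)
  qed
  have "((\<lambda>r. w \<sigma> * prod lam A * (r ^ card (S - A) * t ^ card (A - S)))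
      \<longlongrightarrow> w \<sigma> * prod lam A * (0 ^ card (S - A) * t ^ card (A - S))) (at_right 0)"
    by (intro tendsto_intros)
  \<comment> \<open>\<open>0 ^ card (S - A)\<close> is the indicator of
    \<open>S \<subseteq> A\<close>, because \<open>0 ^ 0 = 1\<close>.\<close>
  moreover have "w \<sigma> * prod lam A * (0 ^ card (S - A) * t ^ card (A - S)) = tilt (pinned w S t) lam \<sigma>"
    by (simp add: tilt_def pinned_def A_def[symmetric] power_0_left)
  ultimately show "((\<lambda>r. W r \<sigma>) \<longlongrightarrow> tilt (pinned w S t) lam \<sigma>) (at_right 0)"
    by (subst tendsto_cong[where g = "\<lambda>r. w \<sigma> * prod lam A * (r ^ card (S - A) * t ^ card (A - S))"])
      (auto simp: eventually_at_filter W_eq)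
qed simp

text \<open>Expanding the product of \<open>(1 - t) + t\<close> over the \<open>+1\<close> vertices
  of \<open>\<sigma>\<close> gives one term for each \<open>S\<close> among them.\<close>

lemma sum_pinned:
  "(\<Sum>S\<in>UNIV. (1 - t) ^ card S * pinned w S t \<sigma>) = w \<sigma>"
proof -
  define A where "A = {v. \<sigma> v}"
  have "(\<Sum>S\<in>UNIV. (1 - t) ^ card S * pinned w S t \<sigma>)
      = (\<Sum>S\<in>Pow A. w \<sigma> * ((1 - t) ^ card S * t ^ card (A - S)))"
    unfolding pinned_def A_def[symmetric] by (rule sum.mono_neutral_cong_right) auto
  also have "\<dots> = w \<sigma> * (\<Prod>v\<in>A. (1 - t) + t)"
    using prod_add[of A "\<lambda>_. 1 - t" "\<lambda>_. t"] by (simp flip: sum_distrib_left)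
  finally show ?thesis by simp
qed

text \<open>Pinning one further \<open>+1\<close> vertex removes one factor \<open>t\<close>; if
  \<open>\<sigma> v\<close> fails, both sides vanish. This converts the \<open>+1\<close>-weights of
  a pinning into masses of larger pinnings.\<close>

lemma pinned_insert:
  assumes "v \<notin> S"
  shows "t * pinned w (insert v S) t \<sigma> = pinned w S t \<sigma> * of_bool (\<sigma> v)"
proof (cases "S \<subseteq> {v. \<sigma> v} \<and> \<sigma> v")
  case True
  have "{v. \<sigma> v} - insert v S = {v. \<sigma> v} - S - {v}" by auto
  then have "card ({v. \<sigma> v} - S) = Suc (card ({v. \<sigma> v} - insert v S))"
    using True assms card_Suc_Diff1[of "{v. \<sigma> v} - S" v] by simp
  then show ?thesis using True by (simp add: pinned_def)
qed (auto simp: pinned_def)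

lemma pinned_mem: "v \<in> S \<Longrightarrow> pinned w S t \<sigma> * of_bool (\<sigma> v) = pinned w S t \<sigma>"
  by (auto simp: pinned_def)

text \<open>The exponent of \<open>t\<close> counts the unpinned \<open>+1\<close> vertices, and the
  power rule yields one equal term for each of them. A vertex with value \<open>-1\<close>
  contributes zero.\<close>

lemma has_derivative_pinned:
  "((\<lambda>t. pinned w S t \<sigma>) has_real_derivative (\<Sum>v\<in>-S. pinned w (insert v S) t \<sigma>)) (at t)"
proof -
  define A where "A = {v. \<sigma> v}"
  have "(\<Sum>v\<in>-S. pinned w (insert v S) t \<sigma>)
      = (\<Sum>v\<in>A - S. w \<sigma> * (of_bool (S \<subseteq> A) * t ^ (card (A - S) - 1)))"
    unfolding pinned_def A_def[symmetric]
  proof (rule sum.mono_neutral_cong_right)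
    fix v assume "v \<in> A - S"
    then have "card (A - insert v S) = card (A - S) - 1"
      by (metis Diff_insert card_Diff_singleton)
    then show "w \<sigma> * (of_bool (insert v S \<subseteq> A) * t ^ card (A - insert v S))
        = w \<sigma> * (of_bool (S \<subseteq> A) * t ^ (card (A - S) - 1))"
      using \<open>v \<in> A - S\<close> by auto
  qed auto
  then show ?thesis
    unfolding pinned_def A_def[symmetric]
    by (auto intro!: derivative_eq_intros simp: mult_ac)
qed

text \<open>Removing \<open>v\<close> from \<open>S\<close> is a bijection between the two index
  sets. It attributes the derivative of the weight \<open>(1 - t) ^ card S\<close> to the pinnings
  with one vertex less.\<close>

lemma sum_mem_eq_sum_insert:
  fixes h :: "'v::finite set \<Rightarrow> 'v \<Rightarrow> real"
  shows "(\<Sum>S\<in>UNIV. \<Sum>v\<in>S. h S v) = (\<Sum>S\<in>UNIV. \<Sum>v\<in>-S. h (insert v S) v)"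
proof -
  have "(\<Sum>S\<in>UNIV. \<Sum>v\<in>S. h S v) = (\<Sum>v\<in>UNIV. \<Sum>S | v \<in> S. h S v)"
    using sum.swap_restrict[of UNIV UNIV "\<lambda>S v. h S v" "\<lambda>S v. v \<in> S"] by simp
  also have "\<dots> = (\<Sum>v\<in>UNIV. \<Sum>S | v \<in> -S. h (insert v S) v)"
  proof (rule sum.cong[OF refl])
    fix v :: 'v
    show "(\<Sum>S | v \<in> S. h S v) = (\<Sum>S | v \<in> -S. h (insert v S) v)"
      by (rule sum.reindex_bij_witness[of _ "insert v" "\<lambda>S. S - {v}"]) (auto simp: insert_absorb)
  qed
  also have "\<dots> = (\<Sum>S\<in>UNIV. \<Sum>v\<in>-S. h (insert v S) v)"
    using sum.swap_restrict[of UNIV UNIV "\<lambda>S v. h (insert v S) v" "\<lambda>S v. v \<notin> S"] by (simp add: Compl_eq)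
  finally show ?thesis .
qed

text \<open>With \<open>F t\<close> the right-hand side at parameter \<open>t\<close>, the
  differential inequality is \<open>t * F' \<le> K * F\<close>. Hence
  \<open>F t * t powr - K\<close> does not increase between \<open>\<theta>\<close> and
  \<open>1\<close>, and \<open>F 1\<close> is the full entropy.\<close>

lemma entropy_conservation:
  fixes w f :: "'v::finite config \<Rightarrow> real"
  assumes w: "\<And>\<sigma>. 0 \<le> w \<sigma>" and f: "\<And>\<sigma>. 0 < w \<sigma> \<Longrightarrow> 0 \<le> f \<sigma>" and K: "K > 0"
    and cov: "\<And>lam. (\<And>v. 0 < lam v) \<Longrightarrow> cov_bounded K (tilt w lam)"
    and \<theta>: "0 < \<theta>" "\<theta> \<le> 1"
  shows "\<theta> powr K * weighted_ent w f \<le> (\<Sum>S\<in>UNIV. (1 - \<theta>) ^ card S * weighted_ent (pinned w S \<theta>) f)"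
proof -
  define F where "F t = (\<Sum>S\<in>UNIV. (1 - t) ^ card S * weighted_ent (pinned w S t) f)" for t
  define a where "a S t = (\<Sum>\<sigma>\<in>UNIV. pinned w S t \<sigma> * f \<sigma>)" for S t
  define b where "b S t = mass (pinned w S t)" for S t
  define L where "L S t = a S t * ln (a S t / b S t)" for S t
  define H where "H = (\<Sum>\<sigma>\<in>UNIV. w \<sigma> * (f \<sigma> * ln (f \<sigma>)))"
  define G where "G t = (\<Sum>S\<in>UNIV. (1 - t) ^ card S * L S t)" for t
  \<comment> \<open>The part with \<open>f \<sigma> * ln (f \<sigma>)\<close> averages to the
    constant \<open>H\<close> by \<open>sum_pinned\<close>, so only \<open>G\<close> varies with
    \<open>t\<close>.\<close>
  have F_eq: "F t = H - G t" for t
  proof -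
    have "(\<Sum>S\<in>UNIV. (1 - t) ^ card S * (\<Sum>\<sigma>\<in>UNIV. pinned w S t \<sigma> * (f \<sigma> * ln (f \<sigma>))))
        = (\<Sum>\<sigma>\<in>UNIV. (\<Sum>S\<in>UNIV. (1 - t) ^ card S * pinned w S t \<sigma>) * (f \<sigma> * ln (f \<sigma>)))"
      unfolding sum_distrib_left sum_distrib_right by (subst sum.swap) (simp only: mult.assoc)
    then show ?thesis
      unfolding F_def G_def H_def L_def a_def b_def weighted_ent_def
      by (simp add: right_diff_distrib sum_subtractf sum_pinned)
  qed
  have nn: "0 \<le> pinned w S t \<sigma> * f \<sigma>" if "0 \<le> t" for S t \<sigma>
    using w[of \<sigma>] f[of \<sigma>] that by (cases "w \<sigma> = 0") (auto simp: pinned_def)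
  have a0: "0 \<le> a S t" if "0 \<le> t" for S t unfolding a_def by (intro sum_nonneg nn that)
  have b0: "0 < b S t" if "0 < t" "0 < a S t" for S t
    unfolding b_def using that w by (intro mass_pos_of_weighted_sum[of _ f] pinned_nonneg) (auto simp: a_def)
  \<comment> \<open>For positive parameters the zero set of \<open>pinned w S t\<close> stays the
    same, so \<open>L S\<close> either vanishes identically or avoids the singularity of the
    logarithm at every \<open>t > 0\<close>.\<close>
  have a_zero: "a S s = 0" if "a S t = 0" "0 < t" for S s t
  proof -
    have "\<forall>\<sigma>. pinned w S t \<sigma> * f \<sigma> = 0"
      using that nn[of t] unfolding a_def by (subst (asm) sum_nonneg_eq_0_iff) auto
    then have "pinned w S s \<sigma> * f \<sigma> = 0" for \<sigma> using \<open>0 < t\<close> by (auto simp: pinned_def)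
    then show ?thesis unfolding a_def by (intro sum.neutral) blast
  qed
  have da: "((\<lambda>t. a S t) has_real_derivative (\<Sum>v\<in>-S. a (insert v S) t)) (at t)" for S t
  proof -
    have "(\<Sum>v\<in>-S. a (insert v S) t) = (\<Sum>\<sigma>\<in>UNIV. (\<Sum>v\<in>-S. pinned w (insert v S) t \<sigma>) * f \<sigma>)"
      unfolding a_def sum_distrib_right by (rule sum.swap)
    then show ?thesis unfolding a_def[abs_def]
      by (auto intro!: DERIV_sum DERIV_cmult_right has_derivative_pinned)
  qed
  have db: "((\<lambda>t. b S t) has_real_derivative (\<Sum>v\<in>-S. b (insert v S) t)) (at t)" for S t
  proof -
    have "(\<Sum>v\<in>-S. b (insert v S) t) = (\<Sum>\<sigma>\<in>UNIV. (\<Sum>v\<in>-S. pinned w (insert v S) t \<sigma>))"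
      unfolding b_def mass_def by (rule sum.swap)
    then show ?thesis unfolding b_def[abs_def] mass_def
      by (auto intro!: DERIV_sum has_derivative_pinned)
  qed
  have at: "t * a (insert v S) t = plus_weight (\<lambda>\<sigma>. pinned w S t \<sigma> * f \<sigma>) v" if "v \<notin> S" for v S t
    unfolding a_def plus_weight_def sum_distrib_left
    by (intro sum.cong refl) (simp add: mult.assoc[symmetric] pinned_insert[OF that])
  have bt: "t * b (insert v S) t = plus_weight (pinned w S t) v" if "v \<notin> S" for v S t
    unfolding b_def mass_def plus_weight_def sum_distrib_left
    by (intro sum.cong refl) (simp add: pinned_insert[OF that])
  \<comment> \<open>The share of \<open>v\<close> in the derivative of
    \<open>a S t * ln (a S t / b S t)\<close>, since \<open>a (insert v S) t\<close> and
    \<open>b (insert v S) t\<close> are the shares of \<open>v\<close> in the derivatives of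
    \<open>a S\<close> and \<open>b S\<close>.\<close>
  define R where "R S v t = a (insert v S) t * ln (a S t / b S t) + a (insert v S) t - b (insert v S) t * (a S t / b S t)" for S v t
  have a_ins: "a (insert v S) t = 0" if "a S t = 0" "v \<notin> S" "0 < t" for v S t
  proof -
    have "\<forall>\<sigma>. pinned w S t \<sigma> * f \<sigma> = 0"
      using that nn[of t] unfolding a_def by (subst (asm) sum_nonneg_eq_0_iff) auto
    then have "plus_weight (\<lambda>\<sigma>. pinned w S t \<sigma> * f \<sigma>) v = 0" unfolding plus_weight_def by (intro sum.neutral) auto
    with at[OF that(2), of t] that show ?thesis by simp
  qed
  have dL: "(L S has_real_derivative (\<Sum>v\<in>-S. R S v t)) (at t)" if t: "0 < t" for S t
  proof (cases "a S t = 0")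
    case True
    then have "L S = (\<lambda>_. 0)" using a_zero[OF _ t] by (auto simp: L_def fun_eq_iff)
    moreover have "(\<Sum>v\<in>-S. R S v t) = 0" using True a_ins t by (intro sum.neutral) (auto simp: R_def)
    ultimately show ?thesis by simp
  next
    case False
    then have ap: "0 < a S t" using a0[of t S] t by simp
    have bp: "0 < b S t" using b0[OF t ap] .
    have R_sum: "(\<Sum>v\<in>-S. R S v t) = (\<Sum>v\<in>-S. a (insert v S) t) * ln (a S t / b S t) + (\<Sum>v\<in>-S. a (insert v S) t)
       - (\<Sum>v\<in>-S. b (insert v S) t) * (a S t / b S t)"
      by (simp only: R_def sum.distrib sum_subtractf sum_distrib_right)
    show ?thesis unfolding L_def[abs_def] R_sum
      by (rule derivative_eq_intros da db refl | use ap bp in \<open>simp add: field_simps; fail\<close>)+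
  qed
  \<comment> \<open>Differentiating the weights gives \<open>card S\<close> copies of
    \<open>L S\<close>, written as a sum over \<open>v \<in> S\<close> and reindexed to
    \<open>insert v S\<close>. What remains compares \<open>L\<close> after pinning \<open>v\<close>
    with the share \<open>R\<close>.\<close>
  define G' where "G' t = - (\<Sum>S\<in>UNIV. (1 - t) ^ card S * (\<Sum>v\<in>-S. L (insert v S) t - R S v t))" for t
  have dG: "(G has_real_derivative G' t) (at t)" if t: "0 < t" for t
  proof -
    have "(G has_real_derivative (\<Sum>S\<in>UNIV. (1 - t) ^ card S * (\<Sum>v\<in>-S. R S v t)
        - (\<Sum>v\<in>S. (1 - t) ^ (card S - 1) * L S t))) (at t)"
      unfolding G_def[abs_def]
      by (rule DERIV_sum) (auto intro!: derivative_eq_intros dL[OF t] simp: algebra_simps)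
    also have "(\<Sum>S\<in>UNIV. (1 - t) ^ card S * (\<Sum>v\<in>-S. R S v t) - (\<Sum>v\<in>S. (1 - t) ^ (card S - 1) * L S t)) = G' t"
    proof -
      have "(\<Sum>S\<in>UNIV. \<Sum>v\<in>S. (1 - t) ^ (card S - 1) * L S t)
          = (\<Sum>S\<in>UNIV. \<Sum>v\<in>-S. (1 - t) ^ (card (insert v S) - 1) * L (insert v S) t)"
        by (rule sum_mem_eq_sum_insert)
      also have "\<dots> = (\<Sum>S\<in>UNIV. (1 - t) ^ card S * (\<Sum>v\<in>-S. L (insert v S) t))"
        unfolding sum_distrib_left by (intro sum.cong refl) auto
      finally show ?thesis
        by (simp add: G'_def sum_subtractf right_diff_distrib)
    qed
    finally show ?thesis .
  qed
  \<comment> \<open>The factor \<open>t\<close> turns \<open>a (insert v S) t\<close> and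
    \<open>b (insert v S) t\<close> into the \<open>+1\<close>-weights \<open>q v\<close> and
    \<open>p v\<close>, so the sum becomes the left-hand side of \<open>entropic_stability\<close>
    for \<open>pinned w S t\<close>.\<close>
  have local: "t * (\<Sum>v\<in>-S. L (insert v S) t - R S v t) \<le> K * weighted_ent (pinned w S t) f" if t: "0 < t" for S t
  proof (cases "a S t = 0")
    case True
    then have "(\<Sum>v\<in>-S. L (insert v S) t - R S v t) = 0"
      using a_ins t by (intro sum.neutral) (auto simp: R_def L_def)
    moreover have "0 \<le> weighted_ent (pinned w S t) f"
      using w t by (intro weighted_ent_nonneg f pinned_nonneg) (auto intro: pos_if_pinned_pos)
    ultimately show ?thesis using K by simp
  next
    case False
    then have ap: "0 < a S t" using a0[of t S] t by simp
    have bp: "0 < b S t" using b0[OF t ap] .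
    define p where "p = plus_weight (pinned w S t)"
    define q where "q = plus_weight (\<lambda>\<sigma>. pinned w S t \<sigma> * f \<sigma>)"
    define h where "h = a S t / b S t"
    have h: "0 < h" using ap bp by (simp add: h_def)
    have "t * (\<Sum>v\<in>-S. L (insert v S) t - R S v t) = (\<Sum>v\<in>-S. q v * ln (q v / p v / h) - q v + p v * h)"
      unfolding sum_distrib_left
    proof (intro sum.cong refl)
      fix v assume "v \<in> - S"
      then have v: "v \<notin> S" by simp
      have qv: "q v = t * a (insert v S) t" and pv: "p v = t * b (insert v S) t"
        using at[OF v] bt[OF v] by (simp_all add: q_def p_def)
      show "t * (L (insert v S) t - R S v t) = q v * ln (q v / p v / h) - q v + p v * h"
      proof (cases "a (insert v S) t = 0")
        case True
        then show ?thesis by (simp add: qv pv R_def L_def h_def)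
      next
        case False
        then have a': "0 < a (insert v S) t" using a0[of t "insert v S"] t by simp
        have b': "0 < b (insert v S) t" using b0[OF t a'] .
        have lnq: "ln (q v / p v / h) = ln (a (insert v S) t / b (insert v S) t) - ln h"
          using t a' b' h by (simp add: qv pv ln_div ln_mult)
        show ?thesis unfolding lnq unfolding qv pv L_def R_def h_def[symmetric] by (simp add: algebra_simps)
      qed
    qed
    \<comment> \<open>A pinned vertex has \<open>p v = b S t\<close> and \<open>q v = a S t\<close>,
      so its term is zero and the sum may run over all vertices.\<close>
    also have "\<dots> = (\<Sum>v\<in>UNIV. q v * ln (q v / p v / h) - q v + p v * h)"
    proof (rule sum.mono_neutral_left)
      show "\<forall>v\<in>UNIV - - S. q v * ln (q v / p v / h) - q v + p v * h = 0"
      proof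
        fix v assume "v \<in> UNIV - - S"
        then have v: "v \<in> S" by simp
        have "p v = b S t" by (simp only: p_def plus_weight_def b_def mass_def pinned_mem[OF v])
        moreover have "q v = a S t"
          unfolding q_def plus_weight_def a_def
        proof (intro sum.cong refl)
          fix \<sigma>
          have "pinned w S t \<sigma> * f \<sigma> * of_bool (\<sigma> v) = (pinned w S t \<sigma> * of_bool (\<sigma> v)) * f \<sigma>"
            by (simp only: mult_ac)
          then show "pinned w S t \<sigma> * f \<sigma> * of_bool (\<sigma> v) = pinned w S t \<sigma> * f \<sigma>"
            by (simp only: pinned_mem[OF v])
        qed
        ultimately show "q v * ln (q v / p v / h) - q v + p v * h = 0"
          using ap bp by (simp add: h_def)
      qed
    qed auto
    also have "\<dots> \<le> K * weighted_ent (pinned w S t) f"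
      unfolding q_def p_def h_def a_def b_def
    proof (rule entropic_stability)
      show "0 < (\<Sum>\<sigma>\<in>UNIV. pinned w S t \<sigma> * f \<sigma>)" using ap by (simp add: a_def)
      show "0 \<le> pinned w S t \<sigma>" for \<sigma> using w t by (simp add: pinned_nonneg)
      show "0 \<le> f \<sigma>" if "0 < pinned w S t \<sigma>" for \<sigma> using pos_if_pinned_pos[OF that w] by (rule f)
      show "cov_bounded K (tilt (pinned w S t) lam)" if "\<And>v. 0 < lam v" for lam
        by (rule cov_bounded_pinned[OF cov t that])
    qed (rule K)
    finally show ?thesis .
  qed
  have key: "t * - G' t \<le> K * F t" if t: "0 < t" "t \<le> 1" for t
  proof -
    have "t * - G' t = (\<Sum>S\<in>UNIV. (1 - t) ^ card S * (t * (\<Sum>v\<in>-S. L (insert v S) t - R S v t)))"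
      by (simp add: G'_def sum_distrib_left mult_ac)
    also have "\<dots> \<le> (\<Sum>S\<in>UNIV. (1 - t) ^ card S * (K * weighted_ent (pinned w S t) f))"
      using t by (intro sum_mono mult_left_mono local) auto
    also have "\<dots> = K * F t" by (simp add: F_def sum_distrib_left mult_ac)
    finally show ?thesis .
  qed
  have "F 1 * 1 powr - K \<le> F \<theta> * \<theta> powr - K"
  proof (rule DERIV_nonpos_imp_nonincreasing[of \<theta> 1 "\<lambda>t. F t * t powr - K"])
    fix t assume "\<theta> \<le> t" "t \<le> 1"
    then have t: "0 < t" "t \<le> 1" using \<theta> by auto
    have "(F has_real_derivative - G' t) (at t)"
      unfolding F_eq[abs_def] by (auto intro!: derivative_eq_intros dG t)
    then have "((\<lambda>t. F t * t powr - K) has_real_derivative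
        - G' t * t powr - K + - K * t powr (- K - 1) * F t) (at t)"
      using t by (intro DERIV_mult has_real_derivative_powr)
    moreover have "- G' t * t powr - K + - K * t powr (- K - 1) * F t = t powr (- K - 1) * (t * - G' t - K * F t)"
      using t by (simp add: powr_diff field_simps)
    moreover have "t powr (- K - 1) * (t * - G' t - K * F t) \<le> 0"
      using key[OF t] by (intro mult_nonneg_nonpos) auto
    ultimately show "\<exists>y. ((\<lambda>t. F t * t powr - K) has_real_derivative y) (at t) \<and> y \<le> 0" by metis
  qed (use \<theta> in auto)
  \<comment> \<open>At \<open>t = 1\<close> the weight \<open>0 ^ card S\<close> keeps only the
    empty pinning.\<close>
  moreover have "F 1 = weighted_ent w f"
  proof -
    have "F 1 = (\<Sum>S\<in>{{}}. (1 - 1) ^ card S * weighted_ent (pinned w S 1) f)"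
      unfolding F_def by (rule sum.mono_neutral_right) auto
    moreover have "pinned w {} 1 = w" by (auto simp: pinned_def fun_eq_iff)
    ultimately show ?thesis by simp
  qed
  ultimately show ?thesis unfolding F_def[symmetric] using \<theta> by (simp add: powr_minus field_simps)
qed

subsection \<open>Spectral independence as a covariance bound\<close>

lemma measure_pmf_eq_sum:
  fixes p :: "'a::finite pmf"
  shows "measure (measure_pmf p) A = (\<Sum>x\<in>UNIV. pmf p x * of_bool (x \<in> A))"
proof -
  have "measure (measure_pmf p) A = sum (pmf p) A" by (simp add: measure_measure_pmf_finite)
  also have "\<dots> = (\<Sum>x\<in>UNIV. pmf p x * of_bool (x \<in> A))"
    by (rule sum.mono_neutral_cong_left) auto
  finally show ?thesis .
qed

lemma expectation_eq_sum:
  fixes p :: "'a::finite pmf" and h :: "'a \<Rightarrow> real"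
  shows "measure_pmf.expectation p h = (\<Sum>x\<in>UNIV. pmf p x * h x)"
  by (subst integral_measure_pmf_real[of UNIV]) (simp_all add: mult.commute)

lemma pmf_marginal_at:
  fixes \<nu> :: "'v::finite config pmf"
  shows "pmf (marginal_at \<nu> v) x = (\<Sum>\<sigma>\<in>UNIV. pmf \<nu> \<sigma> * of_bool (\<sigma> v = x))"
  by (simp only: marginal_at_def pmf_map measure_pmf_eq_sum vimage_def mem_Collect_eq singleton_iff)

lemma mass_pmf: "mass (pmf \<nu>) = 1"
  unfolding mass_def by (rule sum_pmf_eq_1) auto

lemma pmf_pin:
  fixes \<nu> :: "'v::finite config pmf"
  assumes "0 < (\<Sum>\<tau>\<in>UNIV. pmf \<nu> \<tau> * of_bool (\<forall>v\<in>S. \<tau> v = \<sigma> v))"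
  shows "pmf (pin \<nu> S \<sigma>) \<tau> = pmf \<nu> \<tau> * of_bool (\<forall>v\<in>S. \<tau> v = \<sigma> v)
           / (\<Sum>\<tau>\<in>UNIV. pmf \<nu> \<tau> * of_bool (\<forall>v\<in>S. \<tau> v = \<sigma> v))"
proof -
  have "set_pmf \<nu> \<inter> {\<tau>. \<forall>v\<in>S. \<tau> v = \<sigma> v} \<noteq> {}"
  proof
    assume "set_pmf \<nu> \<inter> {\<tau>. \<forall>v\<in>S. \<tau> v = \<sigma> v} = {}"
    then have "pmf \<nu> \<tau> * of_bool (\<forall>v\<in>S. \<tau> v = \<sigma> v) = 0" for \<tau> by (auto simp: set_pmf_iff)
    with assms show False by simp
  qed
  from pmf_cond[OF this] show ?thesis
    unfolding pin_def by (simp add: measure_pmf_eq_sum)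
qed

text \<open>Off the diagonal the covariance is \<open>p u * (1 - p u)\<close> times the influence;
  the diagonal entry is \<open>p u * (1 - p u)\<close> itself and accounts for the
  \<open>+ 1\<close>. If \<open>p u\<close> is \<open>0\<close> or \<open>1\<close>, the whole
  covariance row vanishes.\<close>

lemma cov_bounded_of_spectrally_independent:
  fixes \<nu> :: "'v::finite config pmf"
  assumes "spectrally_independent_infty \<eta> \<nu>" and "0 < \<eta>"
  shows "cov_bounded (\<eta> + 1) (pmf \<nu>)"
  unfolding cov_bounded_def mass_pmf
proof
  fix u
  define p where "p = plus_weight (pmf \<nu>)"
  define p2 where "p2 = plus_weight2 (pmf \<nu>)"
  have p0: "0 \<le> p v" for v unfolding p_def plus_weight_def by (intro sum_nonneg) auto
  have minus: "(\<Sum>\<sigma>\<in>UNIV. pmf \<nu> \<sigma> * of_bool (\<not> \<sigma> v)) = 1 - p v" for v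
  proof -
    have "(\<Sum>\<sigma>\<in>UNIV. pmf \<nu> \<sigma> * of_bool (\<not> \<sigma> v)) = mass (pmf \<nu>) - p v"
      unfolding mass_def p_def plus_weight_def sum_subtractf[symmetric] by (intro sum.cong refl) auto
    then show ?thesis by (simp add: mass_pmf)
  qed
  have p1: "p v \<le> 1" for v
    using minus[of v] sum_nonneg[of UNIV "\<lambda>\<sigma>. pmf \<nu> \<sigma> * of_bool (\<not> \<sigma> v)"] by auto
  have p2_le: "p2 u v \<le> p u" for v
    unfolding p_def p2_def plus_weight_def plus_weight2_def by (intro sum_mono mult_left_mono) auto
  have p2_0: "0 \<le> p2 u v" for v unfolding p2_def plus_weight2_def by (intro sum_nonneg) auto
  have p2_minus: "(\<Sum>\<sigma>\<in>UNIV. pmf \<nu> \<sigma> * (of_bool (\<not> \<sigma> u) * of_bool (\<sigma> v))) = p v - p2 u v" for v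
    unfolding p2_def p_def plus_weight_def plus_weight2_def sum_subtractf[symmetric]
    by (intro sum.cong refl) auto
  have p2_uu: "p2 u u = p u"
    unfolding p2_def p_def plus_weight_def plus_weight2_def by (intro sum.cong refl) auto
  consider "p u = 0" | "p u = 1" | "0 < p u" "p u < 1" using p0[of u] p1[of u] by force
  then have "(\<Sum>v\<in>UNIV. \<bar>p2 u v - p u * p v\<bar>) \<le> (\<eta> + 1) * p u"
  proof cases
    case 1
    then have "p2 u v = 0" for v using p2_le[of v] p2_0[of v] by simp
    then show ?thesis using 1 by simp
  next
    case 2
    have "p2 u v = p v" for v
    proof -
      have "p v - p2 u v \<le> 1 - p u"
        unfolding p2_minus[symmetric] minus[symmetric] by (intro sum_mono mult_left_mono) auto
      moreover have "0 \<le> p v - p2 u v"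
        unfolding p2_minus[symmetric] by (intro sum_nonneg) auto
      ultimately show ?thesis using 2 by simp
    qed
    then show ?thesis using 2 \<open>0 < \<eta>\<close> by simp
  next
    case 3
    define \<Psi> where "\<Psi> v = influence_matrix \<nu> $ u $ v" for v
    have "pmf (marginal_at \<nu> u) True = p u" "pmf (marginal_at \<nu> u) False = 1 - p u"
      unfolding minus[symmetric] by (simp_all add: pmf_marginal_at p_def plus_weight_def)
    then have supp: "set_pmf (marginal_at \<nu> u) = {False, True}"
      using 3 by (auto simp: set_pmf_iff)
    have C: "p2 u v - p u * p v = p u * (1 - p u) * \<Psi> v" if "u \<noteq> v" for v
    proof -
      have "pmf (pin \<nu> {u} (\<lambda>_. True)) \<sigma> = pmf \<nu> \<sigma> * of_bool (\<sigma> u) / p u" for \<sigma>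
        using pmf_pin[of \<nu> "{u}" "\<lambda>_. True"] 3(1) by (simp add: p_def plus_weight_def)
      then have "pmf (marginal_at (pin \<nu> {u} (\<lambda>_. True)) v) True = p2 u v / p u"
        by (simp add: pmf_marginal_at p2_def plus_weight2_def sum_divide_distrib mult.assoc)
      moreover have "pmf (pin \<nu> {u} (\<lambda>_. False)) \<sigma> = pmf \<nu> \<sigma> * of_bool (\<not> \<sigma> u) / (1 - p u)" for \<sigma>
        using pmf_pin[of \<nu> "{u}" "\<lambda>_. False"] 3(2) minus[of u] by simp
      then have "pmf (marginal_at (pin \<nu> {u} (\<lambda>_. False)) v) True = (p v - p2 u v) / (1 - p u)"
        unfolding p2_minus[symmetric] by (simp add: pmf_marginal_at sum_divide_distrib mult.assoc)
      ultimately have "\<Psi> v = p2 u v / p u - (p v - p2 u v) / (1 - p u)"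
        using that supp by (simp add: \<Psi>_def influence_matrix_def)
      then show ?thesis using 3 by (simp add: field_simps)
    qed
    have "(\<Sum>v\<in>UNIV. \<bar>p2 u v - p u * p v\<bar>) \<le> (\<Sum>v\<in>UNIV. p u * (1 - p u) * (\<bar>\<Psi> v\<bar> + of_bool (v = u)))"
    proof (rule sum_mono)
      fix v
      show "\<bar>p2 u v - p u * p v\<bar> \<le> p u * (1 - p u) * (\<bar>\<Psi> v\<bar> + of_bool (v = u))"
      proof (cases "u = v")
        case True
        then have "p2 u v - p u * p v = p u * (1 - p u)" using p2_uu by (simp add: algebra_simps)
        then show ?thesis using True 3 by simp
      next
        case False
        then show ?thesis using C[OF False] 3 by (simp add: abs_mult)
      qed
    qed
    also have "\<dots> = p u * (1 - p u) * ((\<Sum>v\<in>UNIV. \<bar>\<Psi> v\<bar>) + 1)"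
      by (simp add: sum_distrib_left[symmetric] sum.distrib)
    also have "\<dots> \<le> p u * 1 * (\<eta> + 1)"
    proof -
      have "(\<Sum>v\<in>UNIV. \<bar>\<Psi> v\<bar>) \<le> matrix_norm_infty (influence_matrix \<nu>)"
        unfolding matrix_norm_infty_def \<Psi>_def by (intro Max_ge) auto
      also have "\<dots> \<le> \<eta>" using assms by (simp add: spectrally_independent_infty_def)
      finally show ?thesis using 3 \<open>0 < \<eta>\<close> by (intro mult_mono) (auto intro: add_nonneg_nonneg sum_nonneg)
    qed
    finally show ?thesis by (simp add: mult.commute)
  qed
  then show "(\<Sum>v\<in>UNIV. \<bar>1 * plus_weight2 (pmf \<nu>) u v - plus_weight (pmf \<nu>) u * plus_weight (pmf \<nu>) v\<bar>)
      \<le> (\<eta> + 1) * plus_weight (pmf \<nu>) u * 1"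
    by (simp add: p_def p2_def)
qed

lemma cov_bounded_tilt_pmf:
  fixes \<mu> :: "'v::finite config pmf"
  assumes "spectrally_independent_infty_all_fields \<eta> \<mu>" "0 < \<eta>" "\<And>v. 0 < lam v"
  shows "cov_bounded (\<eta> + 1) (tilt (pmf \<mu>) lam)"
proof -
  have "cov_bounded (\<eta> + 1) (pmf (with_field \<mu> lam))"
    using assms by (intro cov_bounded_of_spectrally_independent) (auto simp: spectrally_independent_infty_all_fields_def)
  then have "cov_bounded (\<eta> + 1) (\<lambda>\<sigma>. mass (tilt (pmf \<mu>) lam) * pmf (with_field \<mu> lam) \<sigma>)"
    by (rule cov_bounded_scale)
  moreover have "mass (tilt (pmf \<mu>) lam) * pmf (with_field \<mu> lam) \<sigma> = tilt (pmf \<mu>) lam \<sigma>" for \<sigma>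
  proof -
    have "0 < mass (tilt (pmf \<mu>) lam)"
      using assms(3) by (intro mass_tilt_pos) (auto simp: mass_pmf)
    then show ?thesis
      by (simp add: pmf_with_field[OF assms(3)] field_weight_def[abs_def] tilt_def[abs_def] mass_def)
  qed
  ultimately show ?thesis by simp
qed

subsection \<open>Dirichlet forms under random pinning\<close>

definition flip :: "'v \<Rightarrow> 'v config \<Rightarrow> 'v config" where
  "flip v \<sigma> = \<sigma>(v := \<not> \<sigma> v)"

lemma flip_flip [simp]: "flip v (flip v \<sigma>) = \<sigma>"
  by (auto simp: flip_def)

text \<open>For a probability weight, the first factor is the edge conductance of resampling at
  \<open>v\<close>. Every edge is counted from both endpoints and the vertex choice is left out, so
  the Dirichlet form is this divided by \<open>2 * CARD('v)\<close>. An edge of zero weight at both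
  ends contributes \<open>0 / 0 = 0\<close>.\<close>

definition dirichlet :: "('v::finite config \<Rightarrow> real) \<Rightarrow> ('v config \<Rightarrow> real) \<Rightarrow> real" where
  "dirichlet w f = (\<Sum>v\<in>UNIV. \<Sum>\<sigma>\<in>UNIV. w \<sigma> * w (flip v \<sigma>) / (w \<sigma> + w (flip v \<sigma>))
      * ((f \<sigma> - f (flip v \<sigma>)) * (ln (f \<sigma>) - ln (f (flip v \<sigma>)))))"

text \<open>If this fails, the Dirichlet form is \<open>\<infinity>\<close>; if it holds, the junk value \<open>ln 0 = 0\<close> is harmless in \<open>dirichlet\<close>.\<close>

definition same_zeros :: "('v config \<Rightarrow> real) \<Rightarrow> ('v config \<Rightarrow> real) \<Rightarrow> bool" where
  "same_zeros w f \<longleftrightarrow> (\<forall>\<sigma> v. 0 < w \<sigma> \<longrightarrow> 0 < w (flip v \<sigma>) \<longrightarrow> f \<sigma> = 0 \<longrightarrow> f (flip v \<sigma>) = 0)"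

lemma diff_mult_ln_diff_nonneg:
  fixes x y :: real
  assumes "0 \<le> x" "0 \<le> y" "x = 0 \<longleftrightarrow> y = 0"
  shows "0 \<le> (x - y) * (ln x - ln y)"
proof (cases "x = 0")
  case False
  then have "0 < x" "0 < y" using assms by auto
  then show ?thesis by (cases "x \<le> y") (auto intro: mult_nonneg_nonneg mult_nonpos_nonpos)
qed (use assms in auto)

text \<open>Put \<open>\<tau> = flip v \<sigma>\<close>. Only sets \<open>S\<close> of
  \<open>+1\<close> vertices of \<open>\<tau>\<close> matter; there pinning multiplies
  \<open>w \<tau>\<close> by some \<open>k\<close> and \<open>w \<sigma>\<close> by
  \<open>k * t\<close>. As \<open>t \<le> 1\<close>, the summand is at most \<open>k\<close> times
  the unpinned value \<open>c\<close>, and \<open>sum_pinned\<close> for the constant weight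
  \<open>c\<close> adds up these bounds.\<close>

lemma harmonic_pinned:
  fixes w :: "'v::finite config \<Rightarrow> real"
  assumes w: "\<And>\<sigma>. 0 \<le> w \<sigma>" and t: "0 < t" "t \<le> 1" and \<sigma>: "\<sigma> v"
  shows "(\<Sum>S\<in>UNIV. (1 - t) ^ card S * (pinned w S t \<sigma> * pinned w S t (flip v \<sigma>) / (pinned w S t \<sigma> + pinned w S t (flip v \<sigma>))))
      \<le> w \<sigma> * w (flip v \<sigma>) / (w \<sigma> + w (flip v \<sigma>))"
proof -
  define \<tau> where "\<tau> = flip v \<sigma>"
  define c where "c = w \<sigma> * w \<tau> / (w \<sigma> + w \<tau>)"
  have "(1 - t) ^ card S * (pinned w S t \<sigma> * pinned w S t \<tau> / (pinned w S t \<sigma> + pinned w S t \<tau>))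
      \<le> (1 - t) ^ card S * pinned (\<lambda>_. c) S t \<tau>" for S
  proof (intro mult_left_mono)
    show "pinned w S t \<sigma> * pinned w S t \<tau> / (pinned w S t \<sigma> + pinned w S t \<tau>) \<le> pinned (\<lambda>_. c) S t \<tau>"
    proof (cases "S \<subseteq> {u. \<tau> u} \<and> w \<sigma> \<noteq> 0 \<and> w \<tau> \<noteq> 0")
      case True
      then have wp: "0 < w \<sigma>" "0 < w \<tau>" using w by (auto simp: order_less_le)
      define k where "k = t ^ card ({u. \<tau> u} - S)"
      have k: "0 < k" using t by (simp add: k_def)
      have sets: "{u. \<sigma> u} - S = insert v ({u. \<tau> u} - S)" "v \<notin> {u. \<tau> u} - S" "S \<subseteq> {u. \<sigma> u}"
        using \<sigma> True by (auto simp: \<tau>_def flip_def split: if_splits)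
      have 1: "pinned w S t \<tau> = k * w \<tau>" "pinned (\<lambda>_. c) S t \<tau> = k * c"
        using True by (auto simp: pinned_def k_def)
      have 2: "pinned w S t \<sigma> = k * (t * w \<sigma>)"
        using sets by (simp add: pinned_def k_def)
      have "k * (t * w \<sigma>) * (k * w \<tau>) / (k * (t * w \<sigma>) + k * w \<tau>) = k * (t * w \<sigma> * w \<tau> / (t * w \<sigma> + w \<tau>))"
        using k by (simp flip: distrib_left)
      also have "t * w \<sigma> * w \<tau> / (t * w \<sigma> + w \<tau>) \<le> c"
      proof -
        have "t * (w \<sigma> * w \<tau>) * (w \<sigma> + w \<tau>) \<le> w \<sigma> * w \<tau> * (t * w \<sigma> + w \<tau>)"
        proof -
          have "w \<sigma> * w \<tau> * (t * w \<tau>) \<le> w \<sigma> * w \<tau> * (1 * w \<tau>)"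
            using wp t by (intro mult_left_mono mult_right_mono) auto
          then show ?thesis by (simp add: algebra_simps)
        qed
        moreover have "0 < t * w \<sigma> + w \<tau>" "0 < w \<sigma> + w \<tau>" using wp t by (auto intro!: add_pos_pos)
        ultimately show ?thesis
          unfolding c_def by (simp add: pos_divide_le_eq pos_le_divide_eq mult.assoc)
      qed
      finally show ?thesis using k by (simp add: 1 2)
    next
      case False
      then have "pinned w S t \<tau> = 0 \<or> pinned w S t \<sigma> = 0" by (auto simp: pinned_def)
      moreover have "0 \<le> pinned (\<lambda>_. c) S t \<tau>" using w t by (intro pinned_nonneg) (auto simp: c_def)
      ultimately show ?thesis by auto
    qed
  qed (use t in auto)
  then have "(\<Sum>S\<in>UNIV. (1 - t) ^ card S * (pinned w S t \<sigma> * pinned w S t \<tau> / (pinned w S t \<sigma> + pinned w S t \<tau>)))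
     \<le> (\<Sum>S\<in>UNIV. (1 - t) ^ card S * pinned (\<lambda>_. c) S t \<tau>)" by (rule sum_mono)
  also have "\<dots> = c" by (rule sum_pinned)
  finally show ?thesis by (simp add: c_def \<tau>_def)
qed

text \<open>The factor \<open>e\<close> depending on \<open>f\<close> is common to all pinnings, and
  \<open>same_zeros\<close> makes it nonnegative on edges inside the support, so comparing edge
  weights suffices. \<open>harmonic_pinned\<close> starts from the endpoint with \<open>+1\<close>
  at \<open>v\<close>; symmetry of \<open>hm\<close> covers the other.\<close>

lemma dirichlet_pinned_le:
  fixes w f :: "'v::finite config \<Rightarrow> real"
  assumes w: "\<And>\<sigma>. 0 \<le> w \<sigma>" and f: "\<And>\<sigma>. 0 < w \<sigma> \<Longrightarrow> 0 \<le> f \<sigma>" and good: "same_zeros w f"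
    and t: "0 < t" "t \<le> 1"
  shows "(\<Sum>S\<in>UNIV. (1 - t) ^ card S * dirichlet (pinned w S t) f) \<le> dirichlet w f"
proof -
  define hm where "hm w v \<sigma> = w \<sigma> * w (flip v \<sigma>) / (w \<sigma> + w (flip v \<sigma>))" for w :: "'v config \<Rightarrow> real" and v \<sigma>
  define e where "e v \<sigma> = (f \<sigma> - f (flip v \<sigma>)) * (ln (f \<sigma>) - ln (f (flip v \<sigma>)))" for v \<sigma>
  have sym: "hm w v (flip v \<sigma>) = hm w v \<sigma>" for w v \<sigma> by (simp add: hm_def add.commute mult.commute)
  have hm_le: "(\<Sum>S\<in>UNIV. (1 - t) ^ card S * hm (pinned w S t) v \<sigma>) \<le> hm w v \<sigma>" for v \<sigma>
  proof (cases "\<sigma> v")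
    case True
    then show ?thesis unfolding hm_def by (rule harmonic_pinned[OF w t])
  next
    case False
    then have "flip v \<sigma> v" by (simp add: flip_def)
    from harmonic_pinned[where w=w and \<sigma>="flip v \<sigma>" and v=v, OF w t this] have "(\<Sum>S\<in>UNIV. (1 - t) ^ card S * hm (pinned w S t) v (flip v \<sigma>)) \<le> hm w v (flip v \<sigma>)"
      unfolding hm_def .
    then show ?thesis by (simp add: sym)
  qed
  have "(\<Sum>S\<in>UNIV. (1 - t) ^ card S * dirichlet (pinned w S t) f)
      = (\<Sum>v\<in>UNIV. \<Sum>\<sigma>\<in>UNIV. (\<Sum>S\<in>UNIV. (1 - t) ^ card S * hm (pinned w S t) v \<sigma>) * e v \<sigma>)"
  proof -
    have "(\<Sum>S\<in>UNIV. (1 - t) ^ card S * dirichlet (pinned w S t) f)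
      = (\<Sum>S\<in>UNIV. \<Sum>v\<in>UNIV. \<Sum>\<sigma>\<in>UNIV. (1 - t) ^ card S * hm (pinned w S t) v \<sigma> * e v \<sigma>)"
      unfolding dirichlet_def hm_def e_def sum_distrib_left by (simp only: mult.assoc)
    also have "\<dots> = (\<Sum>v\<in>UNIV. \<Sum>S\<in>UNIV. \<Sum>\<sigma>\<in>UNIV. (1 - t) ^ card S * hm (pinned w S t) v \<sigma> * e v \<sigma>)"
      by (rule sum.swap)
    also have "\<dots> = (\<Sum>v\<in>UNIV. \<Sum>\<sigma>\<in>UNIV. \<Sum>S\<in>UNIV. (1 - t) ^ card S * hm (pinned w S t) v \<sigma> * e v \<sigma>)"
      by (intro sum.cong[OF refl] sum.swap)
    finally show ?thesis by (simp only: sum_distrib_right)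
  qed
  also have "\<dots> \<le> (\<Sum>v\<in>UNIV. \<Sum>\<sigma>\<in>UNIV. hm w v \<sigma> * e v \<sigma>)"
  proof (intro sum_mono)
    fix v \<sigma>
    show "(\<Sum>S\<in>UNIV. (1 - t) ^ card S * hm (pinned w S t) v \<sigma>) * e v \<sigma> \<le> hm w v \<sigma> * e v \<sigma>"
    proof (cases "0 < w \<sigma> \<and> 0 < w (flip v \<sigma>)")
      case True
      then have "f \<sigma> = 0 \<longleftrightarrow> f (flip v \<sigma>) = 0" using good unfolding same_zeros_def by (metis flip_flip)
      then have "0 \<le> e v \<sigma>" unfolding e_def using True f by (intro diff_mult_ln_diff_nonneg) auto
      then show ?thesis by (intro mult_right_mono hm_le)
    next
      case False
      then have "w \<sigma> = 0 \<or> w (flip v \<sigma>) = 0" using w by (metis order_less_le)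
      then have "hm (pinned w S t) v \<sigma> = 0" "hm w v \<sigma> = 0" for S by (auto simp: hm_def pinned_def)
      then show ?thesis by simp
    qed
  qed
  also have "\<dots> = dirichlet w f" by (simp add: dirichlet_def hm_def e_def)
  finally show ?thesis .
qed

lemma dirichlet_nonneg:
  assumes w: "\<And>\<sigma>. 0 \<le> w \<sigma>" and f: "\<And>\<sigma>. 0 < w \<sigma> \<Longrightarrow> 0 \<le> f \<sigma>" and good: "same_zeros w f"
  shows "0 \<le> dirichlet w f"
  unfolding dirichlet_def
proof (intro sum_nonneg)
  fix v \<sigma>
  show "0 \<le> w \<sigma> * w (flip v \<sigma>) / (w \<sigma> + w (flip v \<sigma>)) * ((f \<sigma> - f (flip v \<sigma>)) * (ln (f \<sigma>) - ln (f (flip v \<sigma>))))"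
  proof (cases "0 < w \<sigma> \<and> 0 < w (flip v \<sigma>)")
    case True
    then have "f \<sigma> = 0 \<longleftrightarrow> f (flip v \<sigma>) = 0" using good unfolding same_zeros_def by (metis flip_flip)
    then show ?thesis using True f by (intro mult_nonneg_nonneg diff_mult_ln_diff_nonneg) auto
  next
    case False
    then have "w \<sigma> = 0 \<or> w (flip v \<sigma>) = 0" using w by (metis order_less_le)
    then show ?thesis by auto
  qed
qed

subsection \<open>Glauber dynamics\<close>

lemma weighted_ent_scale:
  assumes "0 < c"
  shows "weighted_ent (\<lambda>\<sigma>. c * w \<sigma>) f = c * weighted_ent w f"
proof -
  have m: "mass (\<lambda>\<sigma>. c * w \<sigma>) = c * mass w" by (simp add: mass_def sum_distrib_left)
  show ?thesis unfolding weighted_ent_def m mult.assoc sum_distrib_left[symmetric]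
    using assms by (simp add: algebra_simps)
qed

lemma dirichlet_scale:
  assumes "0 < c"
  shows "dirichlet (\<lambda>\<sigma>. c * w \<sigma>) f = c * dirichlet w f"
proof -
  have "c * x * (c * y) / (c * x + c * y) = c * (x * y / (x + y))" for x y :: real
    using assms by (simp flip: distrib_left)
  then show ?thesis unfolding dirichlet_def sum_distrib_left by (simp only: mult.assoc)
qed

lemma entropy_of_eq:
  fixes p :: "'v::finite config pmf"
  shows "entropy_of p f = weighted_ent (pmf p) f"
  by (simp add: entropy_of_def weighted_ent_def expectation_eq_sum mass_pmf)

lemma ball_neq_iff: "(\<forall>u\<in>UNIV - {v}. \<tau> u = \<sigma> u) \<longleftrightarrow> \<tau> = \<sigma> \<or> \<tau> = flip v \<sigma>"
  by (auto simp: flip_def fun_eq_iff)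

lemma flip_neq [simp]: "flip v \<sigma> \<noteq> \<sigma>"
  by (metis flip_def fun_upd_same)

lemma sum_of_bool_pair:
  fixes g :: "'v::finite config \<Rightarrow> real"
  shows "(\<Sum>\<tau>\<in>UNIV. g \<tau> * of_bool (\<tau> = \<sigma> \<or> \<tau> = flip v \<sigma>)) = g \<sigma> + g (flip v \<sigma>)"
proof -
  have "(\<Sum>\<tau>\<in>UNIV. g \<tau> * of_bool (\<tau> = \<sigma> \<or> \<tau> = flip v \<sigma>)) = (\<Sum>\<tau>\<in>{\<sigma>, flip v \<sigma>}. g \<tau>)"
    by (rule sum.mono_neutral_cong_right) auto
  then show ?thesis using flip_neq[of v \<sigma>] by simp
qed

text \<open>Resampling at \<open>v\<close> averages \<open>g\<close> over \<open>\<sigma>\<close>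
  and \<open>flip v \<sigma>\<close> in proportion to their probabilities. A general
  \<open>g\<close> serves twice: an indicator gives the transition probabilities,
  \<open>ln (f \<tau>)\<close> gives the Dirichlet form.\<close>

lemma glauber_sum:
  fixes \<nu> :: "'v::finite config pmf"
  assumes "0 < pmf \<nu> \<sigma>"
  shows "(\<Sum>\<tau>\<in>UNIV. glauber \<nu> \<sigma> \<tau> * g \<tau>) =
    (\<Sum>v\<in>UNIV. (pmf \<nu> \<sigma> * g \<sigma> + pmf \<nu> (flip v \<sigma>) * g (flip v \<sigma>)) / (pmf \<nu> \<sigma> + pmf \<nu> (flip v \<sigma>))) / CARD('v)"
proof -
  define M where "M v = marginal_at (pin \<nu> (UNIV - {v}) \<sigma>) v" for v
  have pin: "pmf (pin \<nu> (UNIV - {v}) \<sigma>) \<tau>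
      = pmf \<nu> \<tau> * of_bool (\<tau> = \<sigma> \<or> \<tau> = flip v \<sigma>) / (pmf \<nu> \<sigma> + pmf \<nu> (flip v \<sigma>))" for v \<tau>
    using assms pmf_pin[of \<nu> "UNIV - {v}" \<sigma>] unfolding ball_neq_iff sum_of_bool_pair
    by (simp add: add_pos_nonneg)
  have "(\<Sum>\<tau>\<in>UNIV. pmf (map_pmf (\<lambda>x. \<sigma>(v := x)) (M v)) \<tau> * g \<tau>)
      = (pmf \<nu> \<sigma> * g \<sigma> + pmf \<nu> (flip v \<sigma>) * g (flip v \<sigma>)) / (pmf \<nu> \<sigma> + pmf \<nu> (flip v \<sigma>))" for v
  proof -
    have "(\<Sum>\<tau>\<in>UNIV. pmf (map_pmf (\<lambda>x. \<sigma>(v := x)) (M v)) \<tau> * g \<tau>)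
        = measure_pmf.expectation (map_pmf (\<lambda>x. \<sigma>(v := x)) (M v)) g"
      by (rule expectation_eq_sum[symmetric])
    also have "\<dots> = measure_pmf.expectation (pin \<nu> (UNIV - {v}) \<sigma>) (\<lambda>\<tau>. g (\<sigma>(v := \<tau> v)))"
      by (simp add: M_def marginal_at_def)
    also have "\<dots> = (\<Sum>\<tau>\<in>UNIV. pmf \<nu> \<tau> * g (\<sigma>(v := \<tau> v)) * of_bool (\<tau> = \<sigma> \<or> \<tau> = flip v \<sigma>)) / (pmf \<nu> \<sigma> + pmf \<nu> (flip v \<sigma>))"
      unfolding expectation_eq_sum pin sum_divide_distrib by (intro sum.cong refl) (simp add: mult_ac)
    also have "\<dots> = (pmf \<nu> \<sigma> * g \<sigma> + pmf \<nu> (flip v \<sigma>) * g (flip v \<sigma>)) / (pmf \<nu> \<sigma> + pmf \<nu> (flip v \<sigma>))"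
      unfolding sum_of_bool_pair by (simp add: flip_def)
    finally show ?thesis .
  qed
  moreover have "glauber \<nu> \<sigma> \<tau> = (\<Sum>v\<in>UNIV. pmf (map_pmf (\<lambda>x. \<sigma>(v := x)) (M v)) \<tau>) / CARD('v)" for \<tau>
    unfolding glauber_def glauber_step_def pmf_bind M_def by (subst integral_pmf_of_set) simp_all
  then have "(\<Sum>\<tau>\<in>UNIV. glauber \<nu> \<sigma> \<tau> * g \<tau>)
      = (\<Sum>v\<in>UNIV. \<Sum>\<tau>\<in>UNIV. pmf (map_pmf (\<lambda>x. \<sigma>(v := x)) (M v)) \<tau> * g \<tau>) / CARD('v)"
    by (simp add: sum_divide_distrib sum_distrib_right) (rule sum.swap)
  ultimately show ?thesis by simp
qed

lemma glauber_eq: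
  fixes \<nu> :: "'v::finite config pmf"
  assumes "0 < pmf \<nu> \<sigma>"
  shows "glauber \<nu> \<sigma> \<tau> = (\<Sum>v\<in>UNIV. (pmf \<nu> \<sigma> * of_bool (\<sigma> = \<tau>) + pmf \<nu> (flip v \<sigma>) * of_bool (flip v \<sigma> = \<tau>))
     / (pmf \<nu> \<sigma> + pmf \<nu> (flip v \<sigma>))) / CARD('v)"
  using glauber_sum[OF assms, of "\<lambda>\<rho>. of_bool (\<rho> = \<tau>)"] by simp

lemma glauber_nonneg: "0 \<le> glauber \<nu> \<sigma> \<tau>"
  by (simp add: glauber_def)

lemma glauber_flip_pos:
  fixes \<nu> :: "'v::finite config pmf"
  assumes "0 < pmf \<nu> \<sigma>" "0 < pmf \<nu> (flip v \<sigma>)"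
  shows "0 < glauber \<nu> \<sigma> (flip v \<sigma>)"
  unfolding glauber_eq[OF assms(1)]
  by (intro divide_pos_pos sum_pos2[of _ v]) (use assms in \<open>auto intro!: divide_pos_pos add_pos_pos\<close>)

lemma glauber_eq_0:
  fixes \<nu> :: "'v::finite config pmf"
  assumes "0 < pmf \<nu> \<sigma>" "\<tau> \<noteq> \<sigma>" "\<And>v. \<tau> \<noteq> flip v \<sigma>"
  shows "glauber \<nu> \<sigma> \<tau> = 0"
  unfolding glauber_eq[OF assms(1)] using assms(2,3)[symmetric] by (simp add: eq_commute)

lemma glauber_eq_0_off_support:
  fixes \<nu> :: "'v::finite config pmf"
  assumes "0 < pmf \<nu> \<sigma>" "pmf \<nu> \<tau> = 0"
  shows "glauber \<nu> \<sigma> \<tau> = 0"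
  unfolding glauber_eq[OF assms(1)] using assms by (auto intro!: sum.neutral)

text \<open>\<open>flip v\<close> is an involution preserving the edge weight, so the two halves of
  the symmetric summand have equal sums. The one-sided form is the one that the Dirichlet form of
  the chain produces.\<close>

lemma dirichlet_eq:
  fixes w f :: "'v::finite config \<Rightarrow> real"
  shows "dirichlet w f = 2 * (\<Sum>v\<in>UNIV. \<Sum>\<sigma>\<in>UNIV. w \<sigma> * w (flip v \<sigma>) / (w \<sigma> + w (flip v \<sigma>))
      * (f \<sigma> * (ln (f \<sigma>) - ln (f (flip v \<sigma>)))))"
  unfolding dirichlet_def sum_distrib_left
proof (rule sum.cong[OF refl])
  fix v :: 'v
  let ?h = "\<lambda>\<sigma>. w \<sigma> * w (flip v \<sigma>) / (w \<sigma> + w (flip v \<sigma>))"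
  have "(\<Sum>\<sigma>\<in>UNIV. ?h \<sigma> * (f \<sigma> * (ln (f \<sigma>) - ln (f (flip v \<sigma>)))))
      = (\<Sum>\<sigma>\<in>UNIV. ?h \<sigma> * (f (flip v \<sigma>) * (ln (f (flip v \<sigma>)) - ln (f \<sigma>))))"
    by (rule sum.reindex_bij_witness[of _ "flip v" "flip v"]) (auto simp: add.commute mult.commute)
  then have "(\<Sum>\<sigma>\<in>UNIV. 2 * (?h \<sigma> * (f \<sigma> * (ln (f \<sigma>) - ln (f (flip v \<sigma>))))))
      = (\<Sum>\<sigma>\<in>UNIV. ?h \<sigma> * (f \<sigma> * (ln (f \<sigma>) - ln (f (flip v \<sigma>)))))
        + (\<Sum>\<sigma>\<in>UNIV. ?h \<sigma> * (f (flip v \<sigma>) * (ln (f (flip v \<sigma>)) - ln (f \<sigma>))))"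
    unfolding sum_distrib_left[symmetric] by simp
  also have "\<dots> = (\<Sum>\<sigma>\<in>UNIV. ?h \<sigma> * ((f \<sigma> - f (flip v \<sigma>)) * (ln (f \<sigma>) - ln (f (flip v \<sigma>)))))"
    unfolding sum.distrib[symmetric] distrib_left[symmetric]
    by (intro sum.cong refl arg_cong2[where f = "(*)"]) (simp add: algebra_simps)
  finally show "(\<Sum>\<sigma>\<in>UNIV. ?h \<sigma> * ((f \<sigma> - f (flip v \<sigma>)) * (ln (f \<sigma>) - ln (f (flip v \<sigma>)))))
     = (\<Sum>\<sigma>\<in>UNIV. 2 * (?h \<sigma> * (f \<sigma> * (ln (f \<sigma>) - ln (f (flip v \<sigma>))))))" by simp
qed

text \<open>By \<open>same_zeros\<close>, a state with \<open>f \<sigma> \<noteq> 0\<close> moves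
  only to states where \<open>f\<close> is nonzero, so every logarithm that enters is finite. States
  with \<open>f \<sigma> = 0\<close> contribute zero on both sides.\<close>

lemma dirichlet_form_ln_glauber:
  fixes \<nu> :: "'v::finite config pmf"
  assumes f: "\<And>\<sigma>. 0 < pmf \<nu> \<sigma> \<Longrightarrow> 0 \<le> f \<sigma>" and good: "same_zeros (pmf \<nu>) f"
  shows "dirichlet_form_ln \<nu> (glauber \<nu>) f = ereal (dirichlet (pmf \<nu>) f / (2 * CARD('v)))"
proof -
  define w where "w = pmf \<nu>"
  define I where "I \<sigma> = (\<Sum>\<tau>\<in>UNIV. glauber \<nu> \<sigma> \<tau> * ln (f \<tau>))" for \<sigma>
  have w0: "0 \<le> w \<sigma>" for \<sigma> by (simp add: w_def)
  have supp: "\<sigma> \<in> set_pmf \<nu> \<longleftrightarrow> 0 < w \<sigma>" for \<sigma> by (simp add: w_def pmf_positive_iff)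
  have inner: "(\<Sum>\<tau>\<in>set_pmf \<nu>. ereal (glauber \<nu> \<sigma> \<tau>) * ext_ln (f \<tau>)) = ereal (I \<sigma>)"
    if \<sigma>: "0 < w \<sigma>" "f \<sigma> \<noteq> 0" for \<sigma>
  proof -
    have "(\<Sum>\<tau>\<in>set_pmf \<nu>. ereal (glauber \<nu> \<sigma> \<tau>) * ext_ln (f \<tau>))
        = (\<Sum>\<tau>\<in>set_pmf \<nu>. ereal (glauber \<nu> \<sigma> \<tau> * ln (f \<tau>)))"
    proof (intro sum.cong refl)
      fix \<tau> assume "\<tau> \<in> set_pmf \<nu>"
      show "ereal (glauber \<nu> \<sigma> \<tau>) * ext_ln (f \<tau>) = ereal (glauber \<nu> \<sigma> \<tau> * ln (f \<tau>))"
      proof (cases "glauber \<nu> \<sigma> \<tau> = 0")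
        case False
        then have "\<tau> = \<sigma> \<or> (\<exists>v. \<tau> = flip v \<sigma>)" using glauber_eq_0[of \<nu> \<sigma> \<tau>] \<sigma>(1) by (auto simp: w_def)
        moreover have "f (flip v \<sigma>) \<noteq> 0" if "0 < w (flip v \<sigma>)" for v
          using good \<sigma> that unfolding same_zeros_def w_def[symmetric] by (metis flip_flip)
        ultimately have "f \<tau> \<noteq> 0" using \<sigma> \<open>\<tau> \<in> set_pmf \<nu>\<close> supp by auto
        then show ?thesis by (simp add: ext_ln_def)
      qed (simp add: zero_ereal_def[symmetric])
    qed
    also have "\<dots> = ereal (\<Sum>\<tau>\<in>set_pmf \<nu>. glauber \<nu> \<sigma> \<tau> * ln (f \<tau>))" by (rule sum_ereal)
    also have "(\<Sum>\<tau>\<in>set_pmf \<nu>. glauber \<nu> \<sigma> \<tau> * ln (f \<tau>)) = I \<sigma>"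
      unfolding I_def using \<sigma> by (intro sum.mono_neutral_left)
        (auto simp: w_def set_pmf_iff intro!: glauber_eq_0_off_support)
    finally show ?thesis .
  qed
  have "dirichlet_form_ln \<nu> (glauber \<nu>) f = (\<Sum>\<sigma>\<in>set_pmf \<nu>. ereal (f \<sigma> * (ln (f \<sigma>) - I \<sigma>) * w \<sigma>))"
    unfolding dirichlet_form_ln_def
  proof (intro sum.cong refl)
    fix \<sigma> assume "\<sigma> \<in> set_pmf \<nu>"
    then have \<sigma>: "0 < w \<sigma>" by (simp add: supp)
    show "ereal (f \<sigma>) * (ext_ln (f \<sigma>) - (\<Sum>\<tau>\<in>set_pmf \<nu>. ereal (glauber \<nu> \<sigma> \<tau>) * ext_ln (f \<tau>))) * ereal (pmf \<nu> \<sigma>)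
        = ereal (f \<sigma> * (ln (f \<sigma>) - I \<sigma>) * w \<sigma>)"
    proof (cases "f \<sigma> = 0")
      case False
      then show ?thesis using inner[OF \<sigma> False] by (simp add: ext_ln_def w_def)
    qed (simp add: zero_ereal_def[symmetric])
  qed
  also have "\<dots> = ereal (\<Sum>\<sigma>\<in>set_pmf \<nu>. f \<sigma> * (ln (f \<sigma>) - I \<sigma>) * w \<sigma>)" by (rule sum_ereal)
  also have "(\<Sum>\<sigma>\<in>set_pmf \<nu>. f \<sigma> * (ln (f \<sigma>) - I \<sigma>) * w \<sigma>)
      = (\<Sum>\<sigma>\<in>UNIV. \<Sum>v\<in>UNIV. w \<sigma> * w (flip v \<sigma>) / (w \<sigma> + w (flip v \<sigma>)) * (f \<sigma> * (ln (f \<sigma>) - ln (f (flip v \<sigma>)))) / CARD('v))"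
  proof (rule sum.mono_neutral_cong_left)
    show "\<forall>\<sigma>\<in>UNIV - set_pmf \<nu>. (\<Sum>v\<in>UNIV. w \<sigma> * w (flip v \<sigma>) / (w \<sigma> + w (flip v \<sigma>)) * (f \<sigma> * (ln (f \<sigma>) - ln (f (flip v \<sigma>)))) / CARD('v)) = 0"
      by (auto simp: w_def set_pmf_iff)
    fix \<sigma> assume "\<sigma> \<in> set_pmf \<nu>"
    then have \<sigma>: "0 < w \<sigma>" by (simp add: supp)
    \<comment> \<open>Spreading \<open>ln (f \<sigma>)\<close> evenly over the vertices lets the
      probability of staying at \<open>\<sigma>\<close> cancel vertex by vertex.\<close>
    have "ln (f \<sigma>) - I \<sigma> = (\<Sum>v\<in>(UNIV::'v set). ln (f \<sigma>) / CARD('v)) - I \<sigma>" by simp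
    also have "\<dots> = (\<Sum>v\<in>UNIV. (ln (f \<sigma>) - (w \<sigma> * ln (f \<sigma>) + w (flip v \<sigma>) * ln (f (flip v \<sigma>))) / (w \<sigma> + w (flip v \<sigma>))) / CARD('v))"
      using glauber_sum[of \<nu> \<sigma> "\<lambda>\<tau>. ln (f \<tau>)"] \<sigma> unfolding I_def w_def
      by (simp add: diff_divide_distrib sum_subtractf sum_divide_distrib)
    also have "\<dots> = (\<Sum>v\<in>UNIV. w (flip v \<sigma>) / (w \<sigma> + w (flip v \<sigma>)) * (ln (f \<sigma>) - ln (f (flip v \<sigma>))) / CARD('v))"
    proof (intro sum.cong refl arg_cong2[where f = "(/)"])
      fix v
      have "0 < w \<sigma> + w (flip v \<sigma>)" using \<sigma> w0[of "flip v \<sigma>"] by simp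
      then show "ln (f \<sigma>) - (w \<sigma> * ln (f \<sigma>) + w (flip v \<sigma>) * ln (f (flip v \<sigma>))) / (w \<sigma> + w (flip v \<sigma>))
          = w (flip v \<sigma>) / (w \<sigma> + w (flip v \<sigma>)) * (ln (f \<sigma>) - ln (f (flip v \<sigma>)))"
        by (simp add: field_simps)
    qed
    finally show "f \<sigma> * (ln (f \<sigma>) - I \<sigma>) * w \<sigma>
      = (\<Sum>v\<in>UNIV. w \<sigma> * w (flip v \<sigma>) / (w \<sigma> + w (flip v \<sigma>)) * (f \<sigma> * (ln (f \<sigma>) - ln (f (flip v \<sigma>)))) / CARD('v))"
      by (simp only: sum_distrib_left sum_distrib_right) (simp add: mult_ac)
  qed auto
  also have "\<dots> = dirichlet w f / (2 * CARD('v))"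
    unfolding dirichlet_eq by (subst sum.swap) (simp add: sum_divide_distrib)
  finally show ?thesis by (simp add: w_def)
qed

text \<open>Some state with \<open>f \<sigma> > 0\<close> moves with positive probability to a state
  where the logarithm is \<open>-\<infinity>\<close>. No inner summand is
  \<open>\<infinity>\<close>, so the inner sum is \<open>-\<infinity>\<close>, and one infinite
  outer summand suffices.\<close>

lemma dirichlet_form_ln_glauber_infinite:
  fixes \<nu> :: "'v::finite config pmf"
  assumes f: "\<And>\<sigma>. 0 < pmf \<nu> \<sigma> \<Longrightarrow> 0 \<le> f \<sigma>" and bad: "\<not> same_zeros (pmf \<nu>) f"
  shows "dirichlet_form_ln \<nu> (glauber \<nu>) f = \<infinity>"
proof -
  obtain \<tau> v where \<tau>: "0 < pmf \<nu> \<tau>" "0 < pmf \<nu> (flip v \<tau>)" "f \<tau> = 0" "f (flip v \<tau>) \<noteq> 0"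
    using bad unfolding same_zeros_def by blast
  define \<sigma> where "\<sigma> = flip v \<tau>"
  have \<sigma>: "0 < pmf \<nu> \<sigma>" "0 < f \<sigma>" "\<sigma> \<in> set_pmf \<nu>" "\<tau> \<in> set_pmf \<nu>"
    using \<tau> f[of \<sigma>] by (auto simp: \<sigma>_def pmf_positive_iff)
  have P: "0 < glauber \<nu> \<sigma> \<tau>" using glauber_flip_pos[of \<nu> \<sigma> v] \<tau> by (simp add: \<sigma>_def)
  let ?g = "\<lambda>\<tau>. ereal (glauber \<nu> \<sigma> \<tau>) * ext_ln (f \<tau>)"
  have "(\<Sum>\<rho>\<in>set_pmf \<nu>. ?g \<rho>) = ?g \<tau> + (\<Sum>\<rho>\<in>set_pmf \<nu> - {\<tau>}. ?g \<rho>)"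
    using \<sigma> by (intro sum.remove) auto
  moreover have "?g \<tau> = -\<infinity>" using P \<tau> by (simp add: ext_ln_def)
  moreover have "?g \<rho> \<noteq> \<infinity>" for \<rho>
    using glauber_nonneg[of \<nu> \<sigma> \<rho>] by (auto simp: ext_ln_def)
  then have "(\<Sum>\<rho>\<in>set_pmf \<nu> - {\<tau>}. ?g \<rho>) \<noteq> \<infinity>" by (auto simp: sum_Pinfty)
  ultimately have "(\<Sum>\<rho>\<in>set_pmf \<nu>. ?g \<rho>) = -\<infinity>" by simp
  then have "ereal (f \<sigma>) * (ext_ln (f \<sigma>) - (\<Sum>\<rho>\<in>set_pmf \<nu>. ?g \<rho>)) * ereal (pmf \<nu> \<sigma>) = \<infinity>"
    using \<sigma> by (simp add: ext_ln_def)
  then show ?thesis unfolding dirichlet_form_ln_def sum_Pinfty using \<sigma> by auto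
qed

text \<open>Clearing the denominator also covers functions of zero entropy, which the infimum
  excludes: there the left-hand side is zero and the right-hand side nonnegative.\<close>

lemma mlsi_glauber_le:
  fixes \<nu> :: "'v::finite config pmf"
  assumes r: "ereal r \<le> mlsi_glauber \<nu>"
    and f: "\<And>\<sigma>. 0 < pmf \<nu> \<sigma> \<Longrightarrow> 0 \<le> f \<sigma>" and good: "same_zeros (pmf \<nu>) f"
  shows "r * weighted_ent (pmf \<nu>) f \<le> dirichlet (pmf \<nu>) f / (2 * CARD('v))"
proof (cases "weighted_ent (pmf \<nu>) f = 0")
  case True
  then show ?thesis using dirichlet_nonneg[OF _ f good] by simp
next
  case False
  then have ent: "0 < weighted_ent (pmf \<nu>) f" using weighted_ent_nonneg[of "pmf \<nu>" f] f by (simp add: order_less_le)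
  have "mlsi_glauber \<nu> \<le> dirichlet_form_ln \<nu> (glauber \<nu>) f / ereal (entropy_of \<nu> f)"
    unfolding mlsi_glauber_def by (rule Inf_lower) (use False f in \<open>auto simp: entropy_of_eq pmf_positive_iff\<close>)
  with r have "ereal r \<le> dirichlet_form_ln \<nu> (glauber \<nu>) f / ereal (entropy_of \<nu> f)" by (rule order_trans)
  then have "r \<le> dirichlet (pmf \<nu>) f / (2 * CARD('v)) / weighted_ent (pmf \<nu>) f"
    using ent by (simp add: dirichlet_form_ln_glauber[OF f good] entropy_of_eq)
  then show ?thesis using ent by (simp add: field_simps)
qed

section \<open>Pinnings of the tilted measure and the final comparison\<close>

text \<open>When \<open>S\<close> lies in the \<open>+1\<close> set, the tilt by
  \<open>\<theta>\<close> splits off the constant \<open>\<theta> ^ card S\<close>, which cancels in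
  the normalisation.\<close>

lemma pmf_pin_with_field:
  fixes \<mu> :: "'v::finite config pmf"
  assumes "0 < \<theta>" "0 < mass (pinned (pmf \<mu>) S \<theta>)"
  shows "pmf (pin (with_field \<mu> (\<lambda>_. \<theta>)) S (\<lambda>_. True)) \<sigma>
     = inverse (mass (pinned (pmf \<mu>) S \<theta>)) * pinned (pmf \<mu>) S \<theta> \<sigma>"
proof -
  define Z where "Z = (\<Sum>\<tau>\<in>UNIV. field_weight \<mu> (\<lambda>_. \<theta>) \<tau>)"
  define \<pi> where "\<pi> = with_field \<mu> (\<lambda>_. \<theta>)"
  have "Z = mass (tilt (pmf \<mu>) (\<lambda>_. \<theta>))"
    by (simp add: Z_def mass_def field_weight_def tilt_def)
  then have Z: "0 < Z" using assms by (simp add: mass_tilt_pos mass_pmf)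
  have eq: "pmf \<pi> \<tau> * of_bool (\<forall>v\<in>S. \<tau> v = True) = \<theta> ^ card S / Z * pinned (pmf \<mu>) S \<theta> \<tau>" for \<tau>
  proof (cases "S \<subseteq> {v. \<tau> v}")
    case True
    then have "card {v. \<tau> v} = card S + card ({v. \<tau> v} - S)"
      by (simp add: card_Diff_subset card_mono)
    moreover have "pmf \<pi> \<tau> = field_weight \<mu> (\<lambda>_. \<theta>) \<tau> / Z"
      using assms by (simp add: \<pi>_def Z_def pmf_with_field)
    ultimately show ?thesis using True
      by (auto simp: field_weight_def pinned_def power_add)
  qed (auto simp: pinned_def)
  have sum: "(\<Sum>\<tau>\<in>UNIV. pmf \<pi> \<tau> * of_bool (\<forall>v\<in>S. \<tau> v = True)) = \<theta> ^ card S / Z * mass (pinned (pmf \<mu>) S \<theta>)"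
    unfolding eq mass_def by (simp only: sum_distrib_left)
  have "0 < \<theta> ^ card S / Z * mass (pinned (pmf \<mu>) S \<theta>)" using assms Z by simp
  then have "pmf (pin \<pi> S (\<lambda>_. True)) \<sigma> = (\<theta> ^ card S / Z * pinned (pmf \<mu>) S \<theta> \<sigma>) / (\<theta> ^ card S / Z * mass (pinned (pmf \<mu>) S \<theta>))"
    using pmf_pin[of \<pi> S "\<lambda>_. True" \<sigma>, unfolded sum, unfolded eq] by blast
  then show ?thesis using assms Z by (simp add: \<pi>_def field_simps)
qed

lemma mlsi_glauber_min_le:
  fixes \<mu> :: "'v::finite config pmf"
  assumes "0 < \<theta>" "0 < mass (pinned (pmf \<mu>) S \<theta>)" "S \<noteq> UNIV"
  shows "mlsi_glauber_min (with_field \<mu> (\<lambda>_. \<theta>)) \<le> mlsi_glauber (pin (with_field \<mu> (\<lambda>_. \<theta>)) S (\<lambda>_. True))"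
proof -
  define \<pi> where "\<pi> = with_field \<mu> (\<lambda>_. \<theta>)"
  obtain \<tau> where \<tau>: "0 < pinned (pmf \<mu>) S \<theta> \<tau>"
    using assms by (subst (asm) mass_pos_iff) (auto simp: pinned_nonneg)
  have "0 < mass (tilt (pmf \<mu>) (\<lambda>_. \<theta>))" using assms by (simp add: mass_tilt_pos mass_pmf)
  moreover have "0 < pmf \<mu> \<tau>" using pos_if_pinned_pos[OF \<tau>] by simp
  ultimately have "\<tau> \<in> set_pmf \<pi>"
    using assms by (simp add: \<pi>_def set_pmf_iff pmf_with_field field_weight_def[abs_def] mass_def tilt_def)
  moreover have "S \<subseteq> {v. \<tau> v}" using \<tau> by (rule contrapos_pp) (simp add: pinned_def)
  then have "restrict \<tau> S = restrict (\<lambda>_. True) S" by (auto simp: restrict_def fun_eq_iff)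
  \<comment> \<open>Configurations in the marginal are \<open>undefined\<close> outside
    \<open>S\<close>, so the all-\<open>+1\<close> configuration enters through its restriction;
    \<open>pin\<close> reads only its values on \<open>S\<close>.\<close>
  ultimately have mem: "restrict (\<lambda>_. True) S \<in> set_pmf (marginal \<pi> S)"
    unfolding marginal_def by (metis imageI set_map_pmf)
  have pin: "pin \<pi> S (restrict (\<lambda>_. True) S) = pin \<pi> S (\<lambda>_. True)"
    by (simp add: pin_def)
  show ?thesis unfolding mlsi_glauber_min_def \<pi>_def[symmetric]
    by (rule INF_lower2[of S], use assms in blast, rule INF_lower2[OF mem]) (simp add: pin)
qed

text \<open>The minimum ranges over proper subsets and attainable pinnings only. For zero mass, and
  for \<open>S = UNIV\<close> where the weight sits on one configuration, the entropy is zero and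
  the Dirichlet form nonnegative. Otherwise both sides scale linearly from the normalised
  pinning.\<close>

lemma pinned_inequality:
  fixes \<mu> :: "'v::finite config pmf"
  assumes \<theta>: "0 < \<theta>" and r: "ereal r \<le> mlsi_glauber_min (with_field \<mu> (\<lambda>_. \<theta>))"
    and f: "\<And>\<sigma>. 0 < pmf \<mu> \<sigma> \<Longrightarrow> 0 \<le> f \<sigma>" and good: "same_zeros (pmf \<mu>) f"
  shows "r * weighted_ent (pinned (pmf \<mu>) S \<theta>) f \<le> dirichlet (pinned (pmf \<mu>) S \<theta>) f / (2 * CARD('v))"
proof -
  let ?w = "pinned (pmf \<mu>) S \<theta>"
  have w0: "0 \<le> ?w \<sigma>" for \<sigma> using \<theta> by (simp add: pinned_nonneg)
  have fw: "0 \<le> f \<sigma>" if "0 < ?w \<sigma>" for \<sigma> using f pos_if_pinned_pos[OF that pmf_nonneg] by simp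
  have pos: "0 < pmf \<mu> \<sigma>" if "0 < ?w \<sigma>" for \<sigma> using that by (rule pos_if_pinned_pos) simp
  have goodw: "same_zeros ?w f"
    using good pos unfolding same_zeros_def by blast
  have dnn: "0 \<le> dirichlet ?w f" by (rule dirichlet_nonneg[OF w0 fw goodw])
  consider "mass ?w = 0" | "S = UNIV" | "0 < mass ?w" "S \<noteq> UNIV"
  proof -
    have "0 \<le> mass ?w" unfolding mass_def by (intro sum_nonneg w0)
    then show ?thesis using that by fastforce
  qed
  then show ?thesis
  proof cases
    case 1
    then have "?w \<sigma> = 0" for \<sigma> using w0 unfolding mass_def by (subst (asm) sum_nonneg_eq_0_iff) auto
    then show ?thesis using dnn by (simp add: weighted_ent_def)
  next
    case 2
    have w_eq: "?w \<sigma> = (if \<sigma> = (\<lambda>_. True) then pmf \<mu> (\<lambda>_. True) else 0)" for \<sigma>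
    proof (cases "\<sigma> = (\<lambda>_. True)")
      case False
      then have "\<not> UNIV \<subseteq> {v. \<sigma> v}" by (auto simp: fun_eq_iff)
      then show ?thesis using 2 False by (simp add: pinned_def)
    qed (simp add: pinned_def 2)
    have delta: "(\<Sum>\<sigma>\<in>UNIV. ?w \<sigma> * g \<sigma>) = pmf \<mu> (\<lambda>_. True) * g (\<lambda>_. True)" for g
      unfolding w_eq by (simp add: if_distrib[of "\<lambda>x. x * _"] cong: if_cong)
    have "mass ?w = pmf \<mu> (\<lambda>_. True)" using delta[of "\<lambda>_. 1"] by (simp add: mass_def)
    then have "weighted_ent ?w f = 0" unfolding weighted_ent_def delta by simp
    then show ?thesis using dnn by simp
  next
    case 3
    define c where "c = inverse (mass ?w)"
    define \<nu> where "\<nu> = pin (with_field \<mu> (\<lambda>_. \<theta>)) S (\<lambda>_. True)"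
    have c: "0 < c" using 3 by (simp add: c_def)
    have \<nu>: "pmf \<nu> = (\<lambda>\<sigma>. c * ?w \<sigma>)"
      unfolding \<nu>_def c_def by (rule ext) (rule pmf_pin_with_field[OF \<theta> 3(1)])
    have "ereal r \<le> mlsi_glauber \<nu>" using r mlsi_glauber_min_le[OF \<theta> 3] unfolding \<nu>_def by (rule order_trans)
    then have "r * weighted_ent (pmf \<nu>) f \<le> dirichlet (pmf \<nu>) f / (2 * CARD('v))"
    proof (rule mlsi_glauber_le)
      show "0 \<le> f \<sigma>" if "0 < pmf \<nu> \<sigma>" for \<sigma> using that c fw by (simp add: \<nu> zero_less_mult_iff)
      show "same_zeros (pmf \<nu>) f" using goodw c by (simp add: same_zeros_def \<nu> zero_less_mult_iff)
    qed
    then have "c * (r * weighted_ent ?w f) \<le> c * (dirichlet ?w f / (2 * CARD('v)))"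
      unfolding \<nu> weighted_ent_scale[OF c] dirichlet_scale[OF c] by (simp add: mult_ac)
    then show ?thesis using c by (simp only: mult_le_cancel_left_pos)
  qed
qed

theorem theorem1p6:
  fixes \<mu> :: "('v::finite \<Rightarrow> bool) pmf" and \<eta> \<theta> :: real
  assumes "\<eta> > 0"
    and "spectrally_independent_infty_all_fields \<eta> \<mu>"
    and "0 < \<theta>" and "\<theta> < 1"
  shows "mlsi_glauber \<mu> \<ge>
           ereal ((\<theta> / exp 1) powr (\<eta> + 3)) * mlsi_glauber_min (with_field \<mu> (\<lambda>_. \<theta>))"
proof -
  define C where "C = (\<theta> / exp 1) powr (\<eta> + 3)"
  define M where "M = mlsi_glauber_min (with_field \<mu> (\<lambda>_. \<theta>))"
  have C0: "0 < C" using assms by (simp add: C_def)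
  \<comment> \<open>Dropping the factor \<open>1 / exp 1\<close> enlarges the base, and lowering the
    exponent of a base below \<open>1\<close> enlarges the power.\<close>
  have C_le: "C \<le> \<theta> powr (\<eta> + 1)"
  proof -
    have "C \<le> \<theta> powr (\<eta> + 3)"
      unfolding C_def using assms by (intro powr_mono2) (auto simp: divide_le_eq)
    also have "\<dots> \<le> \<theta> powr (\<eta> + 1)" using assms by (intro powr_mono') auto
    finally show ?thesis .
  qed
  have "ereal C * M \<le> dirichlet_form_ln \<mu> (glauber \<mu>) f / ereal (entropy_of \<mu> f)"
    if "f \<in> set_pmf \<mu> \<rightarrow> {0..}" "entropy_of \<mu> f \<noteq> 0" for f
  proof -
    have f: "0 \<le> f \<sigma>" if "0 < pmf \<mu> \<sigma>" for \<sigma> using \<open>f \<in> _\<close> that by (auto simp: pmf_positive_iff)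
    define E where "E = weighted_ent (pmf \<mu>) f"
    have E: "0 < E" using weighted_ent_nonneg[of "pmf \<mu>" f] f that(2) by (simp add: E_def entropy_of_eq)
    show ?thesis
    proof (cases "same_zeros (pmf \<mu>) f")
      case False
      then show ?thesis using E by (simp add: dirichlet_form_ln_glauber_infinite[OF f False] entropy_of_eq E_def[symmetric])
    next
      case good: True
      define D where "D = dirichlet (pmf \<mu>) f / (2 * CARD('v))"
      have D0: "0 \<le> D" unfolding D_def using dirichlet_nonneg[of "pmf \<mu>" f] f good by simp
      \<comment> \<open>Real lower bounds \<open>r\<close> of \<open>M\<close> keep the argument in
        real arithmetic; \<open>0 \<le> r\<close> allows multiplying the entropy bound by
        \<open>r\<close>.\<close>
      have key: "C * r \<le> D / E" if r: "0 \<le> r" "ereal r \<le> M" for r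
      proof -
        have "C * (r * E) \<le> \<theta> powr (\<eta> + 1) * (r * E)"
          using C_le r E by (intro mult_right_mono) auto
        then have "C * r * E \<le> r * (\<theta> powr (\<eta> + 1) * E)" by (simp only: mult_ac)
        also have "\<dots> \<le> r * (\<Sum>S\<in>UNIV. (1 - \<theta>) ^ card S * weighted_ent (pinned (pmf \<mu>) S \<theta>) f)"
          unfolding E_def using assms f r
          by (intro mult_left_mono entropy_conservation cov_bounded_tilt_pmf) auto
        also have "\<dots> = (\<Sum>S\<in>UNIV. (1 - \<theta>) ^ card S * (r * weighted_ent (pinned (pmf \<mu>) S \<theta>) f))"
          by (simp add: sum_distrib_left mult_ac)
        also have "\<dots> \<le> (\<Sum>S\<in>UNIV. (1 - \<theta>) ^ card S * (dirichlet (pinned (pmf \<mu>) S \<theta>) f / (2 * CARD('v))))"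
          using assms(3,4) r(2) f good unfolding M_def
          by (intro sum_mono mult_left_mono pinned_inequality) auto
        also have "\<dots> = (\<Sum>S\<in>UNIV. (1 - \<theta>) ^ card S * dirichlet (pinned (pmf \<mu>) S \<theta>) f) / (2 * CARD('v))"
          by (simp add: sum_divide_distrib)
        also have "\<dots> \<le> D"
          unfolding D_def using assms(3,4) f good by (intro divide_right_mono dirichlet_pinned_le) auto
        finally show ?thesis using E by (simp add: pos_le_divide_eq)
      qed
      have "ereal C * M \<le> ereal (D / E)"
      proof (cases M)
        case (real r)
        show ?thesis
        proof (cases "0 \<le> r")
          case True
          then show ?thesis using key[of r] real by simp
        next
          case False
          then have "C * r \<le> 0" using C0 by (simp add: mult_nonneg_nonpos)
          also have "0 \<le> D / E" using D0 E by simp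
          finally show ?thesis using real by simp
        qed
      next
        case PInf
        \<comment> \<open>If \<open>M\<close> is infinite, every nonnegative real may serve as
          \<open>r\<close>; this one yields the contradiction
          \<open>D / E + 1 \<le> D / E\<close>.\<close>
        have "C * ((D / E + 1) / C) \<le> D / E" by (rule key) (use D0 E C0 PInf in auto)
        then show ?thesis using C0 by simp
      next
        case MInf
        then show ?thesis using C0 by simp
      qed
      then show ?thesis
        using E by (simp add: dirichlet_form_ln_glauber[OF f good] entropy_of_eq E_def[symmetric] D_def)
    qed
  qed
  then show ?thesis
    unfolding mlsi_glauber_def C_def[symmetric] M_def[symmetric] by (auto intro!: Inf_greatest)
qed

end
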